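(* Let $n\ge4$ and let $G$ be a simple graph on $[n]$ with $m$ edges. Let $t(G)$ be the number of triangles, $s(G)=\sum_v\binom{d_v}{3}$ the number of three-edge stars $K_{1,3}$, $r(G)$ the number of three-edge paths $P_4$, $q(G)$ the number of three-edge subsets of $E(G)$ whose union is a disjoint union of a two-edge path and an edge, and $d_3(G)$ the number of three-edge subsets consisting of three pairwise disjoint edges. Put $$c_2=\tfrac{(n-3)(n-4)}2,\quad c_4=\tfrac{n^2-11n+28}2,\quad c_{32}=\tfrac{n^2-13n+42}2,\quad c_{222}=\tfrac{n^2-15n+60}2.$$ Then $$M_3^{(2)}(G)=c_2\bigl(m+3m(m-1)+6t(G)\bigr)+6c_4\bigl(s(G)+r(G)\bigr)+6c_{32}q(G)+6c_{222}d_3(G),$$ equivalently $$M_3^{(2)}(G)=c_2\bigl(m+3m(m-1)+6t(G)\bigr)+6c_{222}\binom m3+6(c_4-c_{222})(s(G)+r(G))+6(c_{32}-c_{222})q(G)-6c_{222}t(G).$$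
   Context: $d_v$ is the degree of $v$. $M_3^{(2)}(G)=\operatorname{tr}\big((X_G|_{W_n})^3\big)$, where $V_n$ is the complex vector space with basis $e_{ij}$ indexed by unordered pairs $\{i,j\}\subset[n]$ with $S_n$ acting by $\sigma e_{ij}=e_{\sigma(i)\sigma(j)}$, $W_n=\{z\in V_n:\sum_{j\ne i}z_{ij}=0\ \forall i\}$, and $X_G=\sum_{ij\in E(G)}(ij)\in\mathbb C[S_n]$ acting on $W_n$. *)

theory Defs
  imports
    Complex_Main
    "HOL-Library.Function_Algebras"
    "HOL-Library.Ramsey"
    "HOL-Combinatorics.Permutations"
begin

section \<open>Trace of an endomorphism on an invariant subspace\<close>

definition trace_wrt :: "('a::field \<Rightarrow> 'b::ab_group_add \<Rightarrow> 'b) \<Rightarrow> 'b set \<Rightarrow> ('b \<Rightarrow> 'b) \<Rightarrow> 'a"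
  where "trace_wrt scale B T = (\<Sum>b\<in>B. module.representation scale B (T b) b)"

text \<open>
  Meaningful for a finite-dimensional subspace \<open>W\<close> with \<open>T ` W \<subseteq> W\<close>; the choice of
  the basis is then irrelevant by \<open>trace_on_eq\<close> below.
\<close>
definition trace_on :: "('a::field \<Rightarrow> 'b::ab_group_add \<Rightarrow> 'b) \<Rightarrow> 'b set \<Rightarrow> ('b \<Rightarrow> 'b) \<Rightarrow> 'a"
  where "trace_on scale W T =
    trace_wrt scale (SOME B. \<not> module.dependent scale B \<and> module.span scale B = W) T"

context vector_space
begin

lemma trace_wrt_cong_basis:
  assumes B: "independent B" "finite B" "span B = W"
    and C: "independent C" "finite C" "span C = W"
    and T: "Vector_Spaces.linear scale scale T" "T ` W \<subseteq> W"
  shows "trace_wrt scale B T = trace_wrt scale C T"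
proof -
  interpret T: Vector_Spaces.linear scale scale T by (rule T(1))
  have rep_T: "representation P (T b) x =
      (\<Sum>c\<in>Q. representation Q b c * representation P (T c) x)"
    if P: "independent P" "span P = W" and Q: "independent Q" "finite Q" "span Q = W"
      and b: "b \<in> W" for P Q b x
  proof -
    have "b = (\<Sum>c\<in>Q. scale (representation Q b c) c)"
      using sum_representation_eq[OF Q(1) _ Q(2) order_refl] Q(3) b by simp
    then have "T b = (\<Sum>c\<in>Q. scale (representation Q b c) (T c))"
      by (metis (no_types, lifting) T.scale T.sum sum.cong)
    moreover have "T c \<in> span P" if "c \<in> Q" for c
      using that T(2) P(2) Q(3) span_base by blast
    ultimately show ?thesis
      by (simp add: representation_sum[OF P(1)] representation_scale[OF P(1)] span_scale)
  qed
  have inW: "b \<in> W" if "b \<in> B \<or> b \<in> C" for b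
    using that B(3) C(3) span_base by blast
  have expand: "representation B (T c) b =
      (\<Sum>d\<in>C. representation C (T c) d * representation B d b)" if "c \<in> W" for b c
  proof -
    have Tc: "T c \<in> span C" using that T(2) C(3) by blast
    have "T c = (\<Sum>d\<in>C. scale (representation C (T c) d) d)"
      using sum_representation_eq[OF C(1) Tc C(2) order_refl] by simp
    moreover have "d \<in> span B" if "d \<in> C" for d
      using that inW B(3) by blast
    ultimately have "representation B (T c) =
        representation B (\<Sum>d\<in>C. scale (representation C (T c) d) d)" by simp
    also have "\<dots> = (\<lambda>b. \<Sum>d\<in>C. representation C (T c) d * representation B d b)"
      using \<open>\<And>d. d \<in> C \<Longrightarrow> d \<in> span B\<close>
      by (simp add: representation_sum[OF B(1)] representation_scale[OF B(1)] span_scale)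
    finally show ?thesis by simp
  qed
  have "trace_wrt scale B T = (\<Sum>b\<in>B. \<Sum>d\<in>C. representation C (T b) d * representation B d b)"
    unfolding trace_wrt_def by (intro sum.cong refl expand inW disjI1)
  also have "\<dots> = (\<Sum>d\<in>C. \<Sum>b\<in>B. representation B d b * representation C (T b) d)"
    by (subst sum.swap) (simp add: mult.commute)
  also have "\<dots> = trace_wrt scale C T"
    unfolding trace_wrt_def
    by (intro sum.cong refl rep_T[OF C(1,3) B, symmetric] inW disjI2)
  finally show ?thesis .
qed

lemma trace_on_eq:
  assumes B: "independent B" "finite B" "span B = W"
    and T: "Vector_Spaces.linear scale scale T" "T ` W \<subseteq> W"
  shows "trace_on scale W T = trace_wrt scale B T"
proof -
  define C where "C = (SOME B. independent B \<and> span B = W)"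
  have C: "independent C \<and> span C = W"
    unfolding C_def by (rule someI[of _ B]) (use B in auto)
  moreover have "finite C"
    using independent_span_bound[OF B(2), of C] C B(3) span_superset by blast
  ultimately show ?thesis
    unfolding trace_on_def C_def[symmetric]
    using trace_wrt_cong_basis[of C W B T] B T by blast
qed

end


section \<open>The representation\<close>

definition fscale :: "complex \<Rightarrow> ('a \<Rightarrow> complex) \<Rightarrow> 'a \<Rightarrow> complex"
  where "fscale c z = (\<lambda>x. c * z x)"

interpretation cfun: vector_space "fscale :: complex \<Rightarrow> ('a \<Rightarrow> complex) \<Rightarrow> _"
  by unfold_locales (auto simp: fscale_def algebra_simps fun_eq_iff)

text \<open>\<open>[{1..n}]\<^bsup>2\<^esup>\<close> is the set of unordered pairs; \<open>V_space n\<close> is spanned by the vectors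
  \<open>evec p\<close> with \<open>p\<close> such a pair.\<close>

definition evec :: "nat set \<Rightarrow> nat set \<Rightarrow> complex"
  where "evec p = (\<lambda>q. if q = p then 1 else 0)"

definition V_space :: "nat \<Rightarrow> (nat set \<Rightarrow> complex) set"
  where "V_space n = {z. \<forall>p. p \<notin> [{1..n}]\<^bsup>2\<^esup> \<longrightarrow> z p = 0}"

definition W_space :: "nat \<Rightarrow> (nat set \<Rightarrow> complex) set"
  where "W_space n = {z \<in> V_space n. \<forall>i\<in>{1..n}. (\<Sum>j\<in>{1..n} - {i}. z {i, j}) = 0}"

definition perm_act :: "nat \<Rightarrow> (nat \<Rightarrow> nat) \<Rightarrow> (nat set \<Rightarrow> complex) \<Rightarrow> nat set \<Rightarrow> complex"
  where "perm_act n \<sigma> z = (\<Sum>p\<in>[{1..n}]\<^bsup>2\<^esup>. fscale (z p) (evec (\<sigma> ` p)))"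

text \<open>
  An element of the group algebra of \<open>S\<^sub>n\<close> is given by its coefficient function. An edge
  \<open>e = {i, j}\<close> has \<open>transpose (Min e) (Max e) = transpose i j\<close>.
\<close>

definition galg_act ::
    "nat \<Rightarrow> ((nat \<Rightarrow> nat) \<Rightarrow> complex) \<Rightarrow> (nat set \<Rightarrow> complex) \<Rightarrow> nat set \<Rightarrow> complex"
  where "galg_act n a z = (\<Sum>\<sigma> | \<sigma> permutes {1..n}. fscale (a \<sigma>) (perm_act n \<sigma> z))"

definition galg_of :: "(nat \<Rightarrow> nat) \<Rightarrow> (nat \<Rightarrow> nat) \<Rightarrow> complex"
  where "galg_of \<sigma> = (\<lambda>\<tau>. if \<tau> = \<sigma> then 1 else 0)"

definition edge_elt :: "nat set set \<Rightarrow> (nat \<Rightarrow> nat) \<Rightarrow> complex"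
  where "edge_elt E = (\<Sum>e\<in>E. galg_of (transpose (Min e) (Max e)))"

definition M32 :: "nat \<Rightarrow> nat set set \<Rightarrow> complex"
  where "M32 n E = trace_on fscale (W_space n) (galg_act n (edge_elt E) ^^ 3)"

lemma fun_sum_apply: "(\<Sum>i\<in>I. f i) x = (\<Sum>i\<in>I. f i x)"
  for f :: "'i \<Rightarrow> 'a \<Rightarrow> complex"
  by (induction I rule: infinite_finite_induct) auto

lemma subspace_W: "cfun.subspace (W_space n)"
  by (auto simp: cfun.subspace_def W_space_def V_space_def fscale_def sum.distrib
      simp flip: sum_distrib_left)

lemma linear_galg_act: "Vector_Spaces.linear fscale fscale (galg_act n a)"
proof
  show "galg_act n a (x + y) = galg_act n a x + galg_act n a y" for x y
    by (simp add: galg_act_def perm_act_def fun_sum_apply fscale_def fun_eq_iff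
        sum.distrib algebra_simps)
  show "galg_act n a (fscale c x) = fscale c (galg_act n a x)" for c x
    by (auto simp: galg_act_def perm_act_def fun_sum_apply fscale_def fun_eq_iff
        sum_distrib_left mult.left_commute mult.assoc intro!: sum.cong)
qed

lemma image_nsets:
  assumes "\<sigma> permutes A" "p \<in> [A]\<^bsup>k\<^esup>"
  shows "\<sigma> ` p \<in> [A]\<^bsup>k\<^esup>"
  using assms permutes_image[OF assms(1)] permutes_inj_on[OF assms(1), of p]
  by (auto simp: nsets_def card_image)

lemma perm_act_apply:
  assumes \<sigma>: "\<sigma> permutes {1..n}" and q: "q \<in> [{1..n}]\<^bsup>2\<^esup>"
  shows "perm_act n \<sigma> z q = z (inv \<sigma> ` q)"
proof -
  have "q = \<sigma> ` p \<longleftrightarrow> p = inv \<sigma> ` q" for p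
    using permutes_inverses[OF \<sigma>] by (auto simp: image_image)
  then have "perm_act n \<sigma> z q =
      (\<Sum>p\<in>[{1..n}]\<^bsup>2\<^esup>. if p = inv \<sigma> ` q then z p else 0)"
    unfolding perm_act_def fun_sum_apply fscale_def evec_def
    by (intro sum.cong) auto
  also have "\<dots> = z (inv \<sigma> ` q)"
    using image_nsets[OF permutes_inv[OF \<sigma>] q] by (simp add: finite_imp_finite_nsets)
  finally show ?thesis .
qed

lemma perm_act_W:
  assumes \<sigma>: "\<sigma> permutes {1..n}" and z: "z \<in> W_space n"
  shows "perm_act n \<sigma> z \<in> W_space n"
proof -
  have "perm_act n \<sigma> z q = 0" if "q \<notin> [{1..n}]\<^bsup>2\<^esup>" for q
    using that image_nsets[OF \<sigma>, of _ 2]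
    by (auto simp: perm_act_def fun_sum_apply fscale_def evec_def intro!: sum.neutral)
  moreover have "(\<Sum>j\<in>{1..n} - {i}. perm_act n \<sigma> z {i, j}) = 0" if i: "i \<in> {1..n}" for i
  proof -
    have inv: "inv \<sigma> permutes {1..n}" by (rule permutes_inv[OF \<sigma>])
    have "(\<Sum>j\<in>{1..n} - {i}. perm_act n \<sigma> z {i, j}) =
        (\<Sum>j\<in>{1..n} - {i}. z {inv \<sigma> i, inv \<sigma> j})"
      by (rule sum.cong) (use i in \<open>auto simp: perm_act_apply[OF \<sigma>] nsets_def\<close>)
    also have "\<dots> = (\<Sum>j\<in>{1..n} - {inv \<sigma> i}. z {inv \<sigma> i, j})"
    proof (rule sum.reindex_bij_betw)
      have "bij_betw (inv \<sigma>) ({1..n} - {i}) ({1..n} - inv \<sigma> ` {i})"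
        by (rule bij_betw_DiffI[OF permutes_imp_bij[OF inv]])
          (use i permutes_in_image[OF inv, of i] in auto)
      then show "bij_betw (inv \<sigma>) ({1..n} - {i}) ({1..n} - {inv \<sigma> i})" by simp
    qed
    also have "\<dots> = 0"
      using z permutes_in_image[OF inv, THEN iffD2, OF i] unfolding W_space_def by blast
    finally show ?thesis .
  qed
  ultimately show ?thesis by (simp add: W_space_def V_space_def)
qed

lemma galg_act_W: "z \<in> W_space n \<Longrightarrow> galg_act n a z \<in> W_space n"
  unfolding galg_act_def
  by (intro cfun.subspace_sum cfun.subspace_scale subspace_W) (auto intro: perm_act_W)


section \<open>Subgraph counts\<close>

definition degree :: "nat set set \<Rightarrow> nat \<Rightarrow> nat"
  where "degree E v = card {e \<in> E. v \<in> e}"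

definition triangles :: "nat set set \<Rightarrow> nat"
  where "triangles E = card {T. card T = 3 \<and> [T]\<^bsup>2\<^esup> \<subseteq> E}"

definition stars :: "nat \<Rightarrow> nat set set \<Rightarrow> nat"
  where "stars n E = (\<Sum>v\<in>{1..n}. degree E v choose 3)"

definition paths :: "nat set set \<Rightarrow> nat"
  where "paths E = card {F. F \<subseteq> E \<and>
    (\<exists>a b c d. distinct [a, b, c, d] \<and> F = {{a, b}, {b, c}, {c, d}})}"

definition path_plus_edges :: "nat set set \<Rightarrow> nat"
  where "path_plus_edges E = card {F. F \<subseteq> E \<and>
    (\<exists>a b c d e. distinct [a, b, c, d, e] \<and> F = {{a, b}, {b, c}, {d, e}})}"

definition three_matchings :: "nat set set \<Rightarrow> nat"
  where "three_matchings E = card {F. F \<subseteq> E \<and> card F = 3 \<and> pairwise disjnt F}"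

end

theory Submission
  imports Defs
begin

text \<open>
  The trace of \<open>X\<^sub>G\<^sup>3\<close> on \<open>W\<^sub>n\<close> is the sum of the character of \<open>W\<^sub>n\<close> over all products of
  three edge transpositions. Twice this character is \<open>f\<^sub>1\<^sup>2 - 4 f\<^sub>1 + f\<^sub>2\<close>, where \<open>f\<^sub>1\<close> and \<open>f\<^sub>2\<close> count
  the fixed points of the permutation and of its square. A triple with a repeated edge
  multiplies to a transposition. Since the character is invariant under conjugation and
  inversion, its value on three distinct edges does not depend on their order; it depends only on
  the number of vertices that they cover.
\<close>

text \<open>Sending \<open>z\<close> to its vertex sums is an equivariant map from
  \<open>V_space n\<close> to the permutation module on \<open>{1..n}\<close>, onto for n >= 3, with
  kernel \<open>W_space n\<close>. Hence the character is the number of fixed pairs, (f1^2 - 2 f1 +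
  f2) / 2, minus f1. The obstacle is that \<open>W_space n\<close> has no basis on which
  permutations act simply. No explicit basis is chosen: the trace is read off the projected pair
  vectors, and the term -f1 comes out of their correction terms. The constants are the values at
  (f1, f2): (n-2, n) for a transposition gives \<open>c2\<close>, (n-4, n-4) for a 4-cycle gives
  \<open>c4\<close>, (n-5, n-3) for a 3-cycle times a disjoint transposition gives
  \<open>c32\<close>, and (n-6, n) for three disjoint transpositions gives \<open>c222\<close>. In
  the bracket of \<open>c2\<close>, m + 3m(m-1) = m^3 - m(m-1)(m-2) counts the ordered triples with
  a repeated edge; triangles join it because their product is a transposition too. The factors 6 are
  the orders of three distinct edges.\<close>

section \<open>The trace as a sum over triples of edges\<close>

text \<open>This is tr(AB) = tr(BA). Evaluation at the points of \<open>P\<close> followed by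
  recombination with the vectors \<open>u p\<close> is the identity on \<open>W\<close>, so the
  trace on \<open>W\<close> is that of recombination, then \<open>T\<close>, then evaluation, an
  endomorphism of the functions on \<open>P\<close> with diagonal entries \<open>T (u p) p\<close>.
  The \<open>u p\<close> may be linearly dependent.\<close>

lemma trace_on_spanning_family:
  fixes u :: "nat set \<Rightarrow> nat set \<Rightarrow> complex"
  assumes T: "Vector_Spaces.linear fscale fscale T" "T ` W \<subseteq> W"
    and W: "cfun.subspace W" and P: "finite P"
    and u: "\<And>p. p \<in> P \<Longrightarrow> u p \<in> W"
    and repr: "\<And>w. w \<in> W \<Longrightarrow> w = (\<Sum>p\<in>P. fscale (w p) (u p))"
  shows "trace_on fscale W T = (\<Sum>p\<in>P. T (u p) p)"
proof -
  interpret T: Vector_Spaces.linear fscale fscale T by (rule T(1))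
  have span_u: "cfun.span (u ` P) = W"
  proof
    show "cfun.span (u ` P) \<subseteq> W"
      by (rule cfun.span_minimal) (use u W in auto)
    show "W \<subseteq> cfun.span (u ` P)"
    proof
      fix w assume "w \<in> W"
      then have "w = (\<Sum>p\<in>P. fscale (w p) (u p))" by (rule repr)
      also have "\<dots> \<in> cfun.span (u ` P)"
        by (intro cfun.span_sum cfun.span_scale cfun.span_base imageI)
      finally show "w \<in> cfun.span (u ` P)" .
    qed
  qed
  obtain B where B: "B \<subseteq> W" "cfun.independent B" "W \<subseteq> cfun.span B"
    by (rule cfun.basis_exists)
  have finB: "finite B"
    using cfun.independent_span_bound[OF finite_imageI[OF P] B(2)] B(1) span_u by blast
  have spanB: "cfun.span B = W"
    using B(3) cfun.span_minimal[OF B(1) W] by blast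
  have u_span: "u p \<in> cfun.span B" if "p \<in> P" for p
    using u[OF that] spanB by simp
  have "trace_on fscale W T = (\<Sum>b\<in>B. cfun.representation B (T b) b)"
    using cfun.trace_on_eq[OF B(2) finB spanB T] by (simp add: trace_wrt_def)
  also have "\<dots> = (\<Sum>b\<in>B. \<Sum>p\<in>P. T b p * cfun.representation B (u p) b)"
  proof (rule sum.cong[OF refl])
    fix b assume "b \<in> B"
    then have "T b \<in> W" using B(1) T(2) by auto
    then have "cfun.representation B (T b) =
        cfun.representation B (\<Sum>p\<in>P. fscale (T b p) (u p))"
      using repr by simp
    also have "\<dots> = (\<lambda>c. \<Sum>p\<in>P. T b p * cfun.representation B (u p) c)"
      using u_span
      by (simp add: cfun.representation_sum[OF B(2)] cfun.representation_scale[OF B(2)]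
          cfun.span_scale)
    finally show "cfun.representation B (T b) b =
        (\<Sum>p\<in>P. T b p * cfun.representation B (u p) b)" by simp
  qed
  \<comment> \<open>After the swap the inner sum is the expansion of \<open>u p\<close> in the basis
    \<open>B\<close>, pushed through \<open>T\<close>, so the auxiliary basis disappears.\<close>
  also have "\<dots> = (\<Sum>p\<in>P. \<Sum>b\<in>B. cfun.representation B (u p) b * T b p)"
    by (subst sum.swap) (simp add: mult.commute)
  also have "\<dots> = (\<Sum>p\<in>P. T (u p) p)"
  proof (rule sum.cong[OF refl])
    fix p assume p: "p \<in> P"
    have "T (u p) = T (\<Sum>b\<in>B. fscale (cfun.representation B (u p) b) b)"
      using cfun.sum_representation_eq[OF B(2) u_span[OF p] finB order_refl] by simp
    also have "\<dots> = (\<Sum>b\<in>B. fscale (cfun.representation B (u p) b) (T b))"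
      by (simp add: T.sum T.scale)
    finally show "(\<Sum>b\<in>B. cfun.representation B (u p) b * T b p) = T (u p) p"
      by (simp add: fun_sum_apply fscale_def)
  qed
  finally show ?thesis .
qed

section \<open>Sums over pairs and the projected pair vectors\<close>

declare finite_imp_finite_nsets [simp]

lemma pairE:
  assumes "p \<in> [A]\<^bsup>2\<^esup>"
  obtains a b where "p = {a, b}" "a \<noteq> b" "a \<in> A" "b \<in> A"
  using assms unfolding nsets_2_eq by blast

lemma sum_pairs_through:
  fixes f :: "nat set \<Rightarrow> 'a::comm_monoid_add"
  assumes "i \<in> {1..n}"
  shows "(\<Sum>j\<in>{1..n} - {i}. f {i, j}) = (\<Sum>p\<in>{p \<in> [{1..n}]\<^bsup>2\<^esup>. i \<in> p}. f p)"
proof (rule sum.reindex_bij_betw)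
  have "p \<in> (\<lambda>j. {i, j}) ` ({1..n} - {i})" if p: "p \<in> [{1..n}]\<^bsup>2\<^esup>" "i \<in> p" for p
  proof -
    obtain a b where "p = {a, b}" "a \<noteq> b" "a \<in> {1..n}" "b \<in> {1..n}"
      by (rule pairE[OF p(1)])
    then have "p = {i, if i = a then b else a}" "(if i = a then b else a) \<in> {1..n} - {i}"
      using p(2) by auto
    then show ?thesis by blast
  qed
  then have "(\<lambda>j. {i, j}) ` ({1..n} - {i}) = {p \<in> [{1..n}]\<^bsup>2\<^esup>. i \<in> p}"
    using assms by (fastforce simp: nsets_def)
  moreover have "inj_on (\<lambda>j. {i, j}) ({1..n} - {i})"
    by (auto simp: inj_on_def doubleton_eq_iff)
  ultimately show "bij_betw (\<lambda>j. {i, j}) ({1..n} - {i}) {p \<in> [{1..n}]\<^bsup>2\<^esup>. i \<in> p}"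
    by (simp add: bij_betw_def)
qed

text \<open>Double counting of the incidences of a vertex \<open>i\<close> with a pair
  \<open>p\<close>. The summand may depend on \<open>i\<close> as well, which the overlap count for
  the character needs.\<close>

lemma sum_pairs_incidence:
  fixes f :: "nat \<Rightarrow> nat set \<Rightarrow> 'a::comm_monoid_add"
  shows "(\<Sum>i\<in>{1..n}. \<Sum>j\<in>{1..n} - {i}. f i {i, j}) = (\<Sum>p\<in>[{1..n}]\<^bsup>2\<^esup>. \<Sum>i\<in>p. f i p)"
proof -
  have "(\<Sum>i\<in>{1..n}. \<Sum>j\<in>{1..n} - {i}. f i {i, j}) =
      (\<Sum>i\<in>{1..n}. \<Sum>p\<in>{p \<in> [{1..n}]\<^bsup>2\<^esup>. i \<in> p}. f i p)"
    by (intro sum.cong refl sum_pairs_through)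
  also have "\<dots> = (\<Sum>p\<in>[{1..n}]\<^bsup>2\<^esup>. \<Sum>i\<in>{i \<in> {1..n}. i \<in> p}. f i p)"
    by (rule sum.swap_restrict) auto
  also have "\<dots> = (\<Sum>p\<in>[{1..n}]\<^bsup>2\<^esup>. \<Sum>i\<in>p. f i p)"
    by (intro sum.cong refl) (auto simp: nsets_def)
  finally show ?thesis .
qed

lemma sum_pairs_double:
  fixes f :: "nat set \<Rightarrow> complex"
  shows "(\<Sum>i\<in>{1..n}. \<Sum>j\<in>{1..n} - {i}. f {i, j}) = 2 * (\<Sum>p\<in>[{1..n}]\<^bsup>2\<^esup>. f p)"
  unfolding sum_pairs_incidence[where f = "\<lambda>_. f"] sum_distrib_left
  by (intro sum.cong refl) (auto simp: nsets_def)

text \<open>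
  The orthogonal projection of \<open>evec p\<close> to \<open>W_space n\<close>. These vectors are not a basis, but
  \<open>w = (\<Sum>p. w p * wvec n p)\<close> on \<open>W_space n\<close> is enough to compute a trace.
\<close>
definition wvec :: "nat \<Rightarrow> nat set \<Rightarrow> nat set \<Rightarrow> complex"
  where "wvec n p q = (if q \<in> [{1..n}]\<^bsup>2\<^esup> then of_bool (p = q)
    - of_nat (card (p \<inter> q)) / (of_nat n - 2) + 2 / ((of_nat n - 1) * (of_nat n - 2)) else 0)"

lemma card_Int_pair: "finite p \<Longrightarrow> i \<noteq> j \<Longrightarrow>
    (of_nat (card (p \<inter> {i, j})) :: complex) = of_bool (i \<in> p) + of_bool (j \<in> p)"
  by (cases "i \<in> p"; cases "j \<in> p") auto

text \<open>The two coefficients in \<open>wvec\<close> are forced by the vertex sums at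
  \<open>i\<close>: the sum is 1 - n/(n-2) + 2/(n-2) if \<open>i\<close> lies in \<open>p\<close>,
  and 0 - 2/(n-2) + 2/(n-2) otherwise. Both vanish.\<close>

lemma wvec_in_W:
  assumes "n \<ge> 3" and p: "p \<in> [{1..n}]\<^bsup>2\<^esup>"
  shows "wvec n p \<in> W_space n"
proof -
  have fin: "finite p" and card_p: "card p = 2" and p_sub: "p \<subseteq> {1..n}"
    using p by (auto simp: nsets_def)
  have "(\<Sum>j\<in>{1..n} - {i}. wvec n p {i, j}) = 0" if i: "i \<in> {1..n}" for i
  proof -
    have "(\<Sum>j\<in>{1..n} - {i}. of_bool (p = {i, j}) :: complex) = of_bool (i \<in> p)"
      using p by (subst sum_pairs_through[OF i, where f = "\<lambda>q. of_bool (p = q)"])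
        (simp add: of_bool_def sum.delta')
    moreover have "(\<Sum>j\<in>{1..n} - {i}. of_nat (card (p \<inter> {i, j})) :: complex) =
        (\<Sum>j\<in>{1..n} - {i}. of_bool (i \<in> p) + of_bool (j \<in> p))"
      by (intro sum.cong refl card_Int_pair fin) auto
    moreover have "\<dots> = (of_nat n - 1) * of_bool (i \<in> p) + of_nat (card (p - {i}))"
    proof -
      have "({1..n} - {i}) \<inter> {j. j \<in> p} = p - {i}" using p_sub by auto
      moreover have "of_nat (n - Suc 0) = (of_nat n - 1 :: complex)" using assms by (simp add: of_nat_diff)
      ultimately show ?thesis
        using i by (simp add: sum.distrib of_bool_def sum.If_cases)
    qed
    moreover have "of_nat (card (p - {i})) = (2 - of_bool (i \<in> p) :: complex)"
      using card_p fin by (auto simp: card_Diff_singleton_if)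
    moreover have "(\<Sum>j\<in>{1..n} - {i}. wvec n p {i, j}) =
        (\<Sum>j\<in>{1..n} - {i}. of_bool (p = {i, j}) - of_nat (card (p \<inter> {i, j})) / (of_nat n - 2)
          + 2 / ((of_nat n - 1) * (of_nat n - 2)))"
      by (rule sum.cong) (use i in \<open>auto simp: wvec_def nsets_def\<close>)
    moreover have "of_nat (card ({1..n} - {i})) = (of_nat n - 1 :: complex)"
      using i assms by (simp add: of_nat_diff)
    moreover have "of_nat n - 1 \<noteq> (0::complex)" "of_nat n - 2 \<noteq> (0::complex)"
      using assms of_nat_eq_iff[of n 1, where 'a = complex]
        of_nat_eq_iff[of n 2, where 'a = complex] by auto
    ultimately show ?thesis
      by (simp add: sum.distrib sum_subtractf diff_divide_distrib[symmetric] del: sum_of_bool_eq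
          flip: sum_divide_distrib)
        (cases "i \<in> p"; simp add: divide_simps; simp add: algebra_simps)
  qed
  then show ?thesis
    by (auto simp: W_space_def V_space_def wvec_def)
qed

text \<open>Paired with a \<open>w\<close> in \<open>W_space n\<close>, the correction terms of
  \<open>wvec\<close> only see the vertex sums of \<open>w\<close> at the two ends of
  \<open>q\<close> and the total sum of \<open>w\<close>. All of these vanish, so only the delta
  term survives.\<close>

lemma wvec_expansion:
  assumes w: "w \<in> W_space n"
  shows "w = (\<Sum>p\<in>[{1..n}]\<^bsup>2\<^esup>. fscale (w p) (wvec n p))"
proof
  fix q
  have "(\<Sum>p\<in>[{1..n}]\<^bsup>2\<^esup>. w p * wvec n p q) = w q"
  proof (cases "q \<in> [{1..n}]\<^bsup>2\<^esup>")
    case True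
    have through: "(\<Sum>p\<in>[{1..n}]\<^bsup>2\<^esup>. w p * of_bool (k \<in> p)) = 0" if "k \<in> {1..n}" for k
    proof -
      have "(\<Sum>p\<in>[{1..n}]\<^bsup>2\<^esup>. w p * of_bool (k \<in> p)) = (\<Sum>p\<in>{p \<in> [{1..n}]\<^bsup>2\<^esup>. k \<in> p}. w p)"
        by (simp add: of_bool_def if_distrib sum.inter_filter[symmetric] cong: if_cong)
      also have "\<dots> = 0"
        using w that unfolding sum_pairs_through[OF that, symmetric] W_space_def by blast
      finally show ?thesis .
    qed
    \<comment> \<open>Adding up all vertex sums counts every pair twice.\<close>
    have total: "(\<Sum>p\<in>[{1..n}]\<^bsup>2\<^esup>. w p) = 0"
      using w sum_pairs_double[of w n] by (simp add: W_space_def)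
    obtain a b where ab: "q = {a, b}" "a \<noteq> b" "a \<in> {1..n}" "b \<in> {1..n}"
      by (rule pairE[OF True])
    have "(\<Sum>p\<in>[{1..n}]\<^bsup>2\<^esup>. w p * wvec n p q) =
        (\<Sum>p\<in>[{1..n}]\<^bsup>2\<^esup>. (if p = q then w p else 0)
          - (w p * of_bool (a \<in> p) + w p * of_bool (b \<in> p)) / (of_nat n - 2)
          + w p * (2 / ((of_nat n - 1) * (of_nat n - 2))))"
    proof (rule sum.cong[OF refl])
      fix p assume "p \<in> [{1..n}]\<^bsup>2\<^esup>"
      then have "finite p" by (simp add: nsets_def)
      then have "(of_nat (card (p \<inter> q)) :: complex) = of_bool (a \<in> p) + of_bool (b \<in> p)"
        unfolding ab(1) by (rule card_Int_pair[OF _ ab(2)])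
      then show "w p * wvec n p q = (if p = q then w p else 0)
          - (w p * of_bool (a \<in> p) + w p * of_bool (b \<in> p)) / (of_nat n - 2)
          + w p * (2 / ((of_nat n - 1) * (of_nat n - 2)))"
        using True by (simp add: wvec_def algebra_simps add_divide_distrib)
    qed
    also have "\<dots> = w q"
      using True through[OF ab(3)] through[OF ab(4)] total
      by (simp add: sum.distrib sum_subtractf flip: sum_divide_distrib sum_distrib_right)
    finally show ?thesis .
  next
    case False
    then show ?thesis using w by (simp add: wvec_def W_space_def V_space_def)
  qed
  then show "w q = (\<Sum>p\<in>[{1..n}]\<^bsup>2\<^esup>. fscale (w p) (wvec n p)) q"
    by (simp add: fun_sum_apply fscale_def)
qed

section \<open>Edge transpositions acting on coordinates\<close>

abbreviation edge_transp :: "nat set \<Rightarrow> nat \<Rightarrow> nat"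
  where "edge_transp e \<equiv> transpose (Min e) (Max e)"

lemma edge_transp_pair: "edge_transp {a, b} = transpose a b"
  by (cases "a \<le> b") (auto simp: max_def min_def transpose_commute)

lemma edge_transp_permutes:
  assumes "e \<in> [{1..n}]\<^bsup>2\<^esup>"
  shows "edge_transp e permutes {1..n}"
proof -
  obtain a b where "e = {a, b}" "a \<in> {1..n}" "b \<in> {1..n}"
    by (rule pairE[OF assms])
  then show ?thesis by (simp only: edge_transp_pair permutes_swap_id)
qed

text \<open>A permutation acts on coordinates by pulling back along its inverse; a transposition is
  its own inverse, so no inverse is left.\<close>

lemma galg_act_edge_elt:
  assumes E: "E \<subseteq> [{1..n}]\<^bsup>2\<^esup>" and q: "q \<in> [{1..n}]\<^bsup>2\<^esup>"
  shows "galg_act n (edge_elt E) z q = (\<Sum>e\<in>E. z (edge_transp e ` q))"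
proof -
  have "galg_act n (edge_elt E) z q = (\<Sum>\<sigma> | \<sigma> permutes {1..n}.
      \<Sum>e\<in>E. if \<sigma> = edge_transp e then perm_act n \<sigma> z q else 0)"
    by (simp add: galg_act_def edge_elt_def galg_of_def fscale_def fun_sum_apply sum_distrib_right
        if_distrib[of "\<lambda>c. c * _"] cong: if_cong)
  also have "\<dots> = (\<Sum>e\<in>E. \<Sum>\<sigma> | \<sigma> permutes {1..n}.
      if \<sigma> = edge_transp e then perm_act n \<sigma> z q else 0)"
    by (rule sum.swap)
  also have "\<dots> = (\<Sum>e\<in>E. z (edge_transp e ` q))"
  proof (rule sum.cong[OF refl])
    fix e assume "e \<in> E"
    then have "edge_transp e permutes {1..n}" using E edge_transp_permutes by blast
    then show "(\<Sum>\<sigma> | \<sigma> permutes {1..n}. if \<sigma> = edge_transp e then perm_act n \<sigma> z q else 0) =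
        z (edge_transp e ` q)"
      using finite_permutations[of "{1..n}"] perm_act_apply[of "edge_transp e" n q z] q
      by simp
  qed
  finally show ?thesis .
qed

text \<open>The diagonal sum of \<open>trace_on_spanning_family\<close> for the pullback of
  \<open>z\<close> along \<sigma>. For n >= 3 and a permutation \<sigma> it is thus the character at
  the inverse of \<sigma>; by \<open>W_char_inverse\<close> the distinction does not matter.\<close>

definition W_char :: "nat \<Rightarrow> (nat \<Rightarrow> nat) \<Rightarrow> complex"
  where "W_char n \<sigma> = (\<Sum>p\<in>[{1..n}]\<^bsup>2\<^esup>. wvec n p (\<sigma> ` p))"

lemma M32_eq_sum_W_char:
  assumes "n \<ge> 4" and E: "E \<subseteq> [{1..n}]\<^bsup>2\<^esup>"
  shows "M32 n E = (\<Sum>e1\<in>E. \<Sum>e2\<in>E. \<Sum>e3\<in>E.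
    W_char n (edge_transp e3 \<circ> edge_transp e2 \<circ> edge_transp e1))"
proof -
  let ?T = "galg_act n (edge_elt E)" and ?P = "[{1..n}]\<^bsup>2\<^esup>"
  interpret T: Vector_Spaces.linear fscale fscale ?T by (rule linear_galg_act)
  have "Vector_Spaces.linear fscale fscale (?T ^^ 3)"
    by unfold_locales (simp_all add: numeral_3_eq_3 T.add T.scale)
  moreover have "(?T ^^ 3) ` W_space n \<subseteq> W_space n"
    by (auto simp: numeral_3_eq_3 intro!: galg_act_W)
  ultimately have "M32 n E = (\<Sum>p\<in>?P. (?T ^^ 3) (wvec n p) p)"
    unfolding M32_def
    by (rule trace_on_spanning_family[OF _ _ subspace_W])
      (use assms wvec_in_W wvec_expansion in auto)
  also have "\<dots> = (\<Sum>p\<in>?P. \<Sum>e1\<in>E. \<Sum>e2\<in>E. \<Sum>e3\<in>E.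
      wvec n p ((edge_transp e3 \<circ> edge_transp e2 \<circ> edge_transp e1) ` p))"
  proof (rule sum.cong[OF refl])
    fix p assume p: "p \<in> ?P"
    have im: "edge_transp e ` q \<in> ?P" if "e \<in> E" "q \<in> ?P" for e q
      using image_nsets[OF edge_transp_permutes] that E by blast
    \<comment> \<open>The outermost factor is unfolded first and moves the argument \<open>p\<close>
      first, hence \<open>e1\<close> is innermost. By \<open>im\<close> the argument stays a pair,
      so each further factor can be unfolded in the same way.\<close>
    have "(?T ^^ 3) (wvec n p) p = (\<Sum>e1\<in>E. \<Sum>e2\<in>E. \<Sum>e3\<in>E.
        wvec n p (edge_transp e3 ` edge_transp e2 ` edge_transp e1 ` p))"
      using p by (simp add: numeral_3_eq_3 galg_act_edge_elt[OF E] im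
          del: One_nat_def cong: sum.cong)
    then show "(?T ^^ 3) (wvec n p) p = (\<Sum>e1\<in>E. \<Sum>e2\<in>E. \<Sum>e3\<in>E.
        wvec n p ((edge_transp e3 \<circ> edge_transp e2 \<circ> edge_transp e1) ` p))"
      by (simp only: image_comp o_assoc)
  qed
  also have "\<dots> = (\<Sum>e1\<in>E. \<Sum>e2\<in>E. \<Sum>e3\<in>E.
    W_char n (edge_transp e3 \<circ> edge_transp e2 \<circ> edge_transp e1))"
    unfolding W_char_def by (simp only: sum.swap[where A = ?P and B = E])
  finally show ?thesis .
qed

section \<open>Character values\<close>

text \<open>The three terms of \<open>wvec\<close> are summed separately: they give the number of
  pairs fixed as sets, the total overlap of \<open>p\<close> with its image, and a multiple of the
  number of pairs. The parts with denominator n - 2 cancel, and the overlap leaves -2 f1.\<close>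

lemma two_W_char_eq:
  assumes n: "n \<ge> 3" and \<sigma>: "\<sigma> permutes {1..n}"
  defines "f1 \<equiv> of_nat (card {x \<in> {1..n}. \<sigma> x = x}) :: complex"
    and "f2 \<equiv> of_nat (card {x \<in> {1..n}. \<sigma> (\<sigma> x) = x}) :: complex"
  shows "2 * W_char n \<sigma> = f1 ^ 2 - 4 * f1 + f2"
proof -
  let ?N = "{1..n}" and ?P = "[{1..n}]\<^bsup>2\<^esup>"
  let ?F1 = "{x \<in> ?N. \<sigma> x = x}" and ?F2 = "{x \<in> ?N. \<sigma> (\<sigma> x) = x}"
  have inj: "\<sigma> x = \<sigma> y \<longleftrightarrow> x = y" for x y
    using permutes_inj[OF \<sigma>] by (auto dest: injD)
  have mem: "\<sigma> x \<in> ?N \<longleftrightarrow> x \<in> ?N" for x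
    by (rule permutes_in_image[OF \<sigma>])
  have count: "(\<Sum>x\<in>A. of_bool (Q x) :: complex) = of_nat (card {x \<in> A. Q x})"
    if "finite A" for A :: "nat set" and Q
    using that by (simp add: of_bool_def sum.If_cases Int_def)
  have sum_F1: "(\<Sum>i\<in>?N. if \<sigma> i = i then c else 0) = f1 * c" for c :: complex
    unfolding f1_def by (simp add: sum.If_cases Int_def)
  have fixed_pairs: "2 * (\<Sum>p\<in>?P. of_bool (p = \<sigma> ` p)) = f1 * (f1 - 1) + f2 - f1"
  proof -
    \<comment> \<open>A fixed \<open>i\<close> can be paired with any other fixed point, and an
      \<open>i\<close> on a 2-cycle only with its image. Fixed points also satisfy \<sigma>
      (\<sigma> i) = i, so they are subtracted from the count of the latter.\<close>
    have "(\<Sum>j\<in>?N - {i}. of_bool ({i, j} = \<sigma> ` {i, j})) =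
        (if \<sigma> i = i then f1 - 1 else 0) + of_bool (\<sigma> (\<sigma> i) = i) - (if \<sigma> i = i then 1 else 0)"
      if i: "i \<in> ?N" for i
    proof (cases "\<sigma> i = i")
      case True
      have "(\<Sum>j\<in>?N - {i}. of_bool ({i, j} = \<sigma> ` {i, j})) =
          (\<Sum>j\<in>?N - {i}. of_bool (\<sigma> j = j) :: complex)"
        by (intro sum.cong refl arg_cong[where f = of_bool]) (use True in \<open>auto simp: doubleton_eq_iff\<close>)
      also have "\<dots> = of_nat (card (?F1 - {i}))"
        by (subst count) (auto intro!: arg_cong[where f = card])
      also have "\<dots> = f1 - 1"
        unfolding f1_def using True i by (subst card.remove[of ?F1 i]) simp_all
      finally show ?thesis using True by simp
    next
      case False
      have "(\<Sum>j\<in>?N - {i}. of_bool ({i, j} = \<sigma> ` {i, j})) =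
          (\<Sum>j\<in>?N - {i}. if j = \<sigma> i then of_bool (\<sigma> (\<sigma> i) = i) else 0 :: complex)"
        by (intro sum.cong refl) (use False in \<open>auto simp: doubleton_eq_iff\<close>)
      also have "\<dots> = of_bool (\<sigma> (\<sigma> i) = i)"
        using False i mem[of i] by (subst sum.delta) auto
      finally show ?thesis using False by simp
    qed
    then have "2 * (\<Sum>p\<in>?P. of_bool (p = \<sigma> ` p)) = (\<Sum>i\<in>?N.
        (if \<sigma> i = i then f1 - 1 else 0) + of_bool (\<sigma> (\<sigma> i) = i) - (if \<sigma> i = i then 1 else 0))"
      unfolding sum_pairs_double[of "\<lambda>p. of_bool (p = \<sigma> ` p)" n, symmetric]
      by (intro sum.cong refl)
    also have "\<dots> = f1 * (f1 - 1) + f2 - f1"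
      unfolding sum_subtractf sum.distrib sum_F1 count[OF finite_atLeastAtMost] f2_def by simp
    finally show ?thesis .
  qed
  have overlap: "(\<Sum>p\<in>?P. of_nat (card (p \<inter> \<sigma> ` p))) = f1 * (of_nat n - 2) + of_nat n"
  proof -
    have "(\<Sum>p\<in>?P. of_nat (card (p \<inter> \<sigma> ` p)) :: complex) =
        (\<Sum>p\<in>?P. \<Sum>i\<in>p. of_bool (i \<in> \<sigma> ` p))"
    proof (intro sum.cong refl)
      fix p assume "p \<in> ?P"
      then have "finite p" by (simp add: nsets_def)
      then show "(of_nat (card (p \<inter> \<sigma> ` p)) :: complex) = (\<Sum>i\<in>p. of_bool (i \<in> \<sigma> ` p))"
        by (simp only: count Int_def mem_Collect_eq)
    qed
    also have "\<dots> = (\<Sum>i\<in>?N. \<Sum>j\<in>?N - {i}. of_bool (i \<in> \<sigma> ` {i, j}))"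
      by (rule sum_pairs_incidence[symmetric])
    \<comment> \<open>If \<open>i\<close> is fixed, all n - 1 partners \<open>j\<close> count;
      otherwise the preimage of \<open>i\<close> is the only one. The common 1 is split off.\<close>
    also have "\<dots> = (\<Sum>i\<in>?N. (if \<sigma> i = i then of_nat n - 2 else 0) + 1)"
    proof (intro sum.cong refl)
      fix i assume i: "i \<in> ?N"
      show "(\<Sum>j\<in>?N - {i}. of_bool (i \<in> \<sigma> ` {i, j})) =
          (if \<sigma> i = i then of_nat n - 2 else 0) + (1::complex)"
      proof (cases "\<sigma> i = i")
        case True
        then show ?thesis using i n by (simp add: of_nat_diff)
      next
        case False
        have "i \<in> \<sigma> ` {i, j} \<longleftrightarrow> j = inv \<sigma> i" for j
          using False permutes_inv_eq[OF \<sigma>, of i j] by auto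
        then have "(\<Sum>j\<in>?N - {i}. of_bool (i \<in> \<sigma> ` {i, j})) =
            (\<Sum>j\<in>?N - {i}. if j = inv \<sigma> i then 1 else 0 :: complex)"
          by (simp only: of_bool_def)
        moreover have "inv \<sigma> i \<in> ?N - {i}"
          using False i permutes_inverses(1)[OF \<sigma>, of i] permutes_in_image[OF permutes_inv[OF \<sigma>], of i]
          by auto
        ultimately show ?thesis using False by simp
      qed
    qed
    also have "\<dots> = f1 * (of_nat n - 2) + of_nat n"
      unfolding sum.distrib sum_F1 by simp
    finally show ?thesis .
  qed
  have card_P: "2 * of_nat (card ?P) = of_nat n * (of_nat n - 1 :: complex)"
  proof -
    have "2 * of_nat (card ?P) = (\<Sum>i\<in>?N. \<Sum>j\<in>?N - {i}. 1 :: complex)"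
      unfolding sum_pairs_double[of "\<lambda>_. 1" n] by simp
    also have "\<dots> = (\<Sum>i\<in>?N. of_nat n - 1)"
      using n by (intro sum.cong refl) (simp add: of_nat_diff)
    finally show ?thesis by simp
  qed
  have "W_char n \<sigma> = (\<Sum>p\<in>?P. of_bool (p = \<sigma> ` p)
      - of_nat (card (p \<inter> \<sigma> ` p)) / (of_nat n - 2) + 2 / ((of_nat n - 1) * (of_nat n - 2)))"
    unfolding W_char_def wvec_def using image_nsets[OF \<sigma>, of _ 2] by (intro sum.cong refl) simp
  then have "2 * W_char n \<sigma> = 2 * (\<Sum>p\<in>?P. of_bool (p = \<sigma> ` p))
      - 2 * (\<Sum>p\<in>?P. of_nat (card (p \<inter> \<sigma> ` p))) / (of_nat n - 2)
      + 2 * of_nat (card ?P) * (2 / ((of_nat n - 1) * (of_nat n - 2)))"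
    by (simp only: sum.distrib sum_subtractf sum_divide_distrib[symmetric] sum_constant
        right_diff_distrib distrib_left times_divide_eq_right mult.assoc)
  also have "\<dots> = f1 * (f1 - 1) + f2 - f1 - 2 * (f1 * (of_nat n - 2) + of_nat n) / (of_nat n - 2)
      + of_nat n * (of_nat n - 1) * (2 / ((of_nat n - 1) * (of_nat n - 2)))"
    unfolding fixed_pairs overlap card_P ..
  also have "\<dots> = f1 ^ 2 - 4 * f1 + f2"
  proof -
    have "of_nat n - 1 \<noteq> (0::complex)" "of_nat n - 2 \<noteq> (0::complex)"
      using n of_nat_eq_iff[of n 1, where 'a = complex]
        of_nat_eq_iff[of n 2, where 'a = complex] by auto
    then have "2 * (f1 * (of_nat n - 2) + of_nat n) / (of_nat n - 2)
        = 2 * f1 + 2 * of_nat n / (of_nat n - 2)"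
      and "of_nat n * (of_nat n - 1) * (2 / ((of_nat n - 1) * (of_nat n - 2)))
        = 2 * of_nat n / (of_nat n - 2 :: complex)"
      by (simp_all add: divide_simps)
    then show ?thesis by (simp add: power2_eq_square algebra_simps)
  qed
  finally show ?thesis .
qed

text \<open>For a product of few transpositions the moved points can be listed and do not depend on
  \<open>n\<close>, while the fixed points cannot; hence the complementary counts.\<close>

lemma W_char_moved:
  assumes n: "n \<ge> 3" and \<sigma>: "\<sigma> permutes {1..n}"
    and M1: "{x \<in> {1..n}. \<sigma> x \<noteq> x} = M1" and M2: "{x \<in> {1..n}. \<sigma> (\<sigma> x) \<noteq> x} = M2"
  shows "W_char n \<sigma> = ((of_nat n - of_nat (card M1)) ^ 2 - 4 * (of_nat n - of_nat (card M1))
    + (of_nat n - of_nat (card M2))) / 2"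
proof -
  have card_fixed: "(of_nat (card {x \<in> {1..n}. Q x}) :: complex) =
      of_nat n - of_nat (card {x \<in> {1..n}. \<not> Q x})" for Q
  proof -
    have "{x \<in> {1..n}. Q x} \<union> {x \<in> {1..n}. \<not> Q x} = {1..n}" by auto
    then have "card {x \<in> {1..n}. Q x} + card {x \<in> {1..n}. \<not> Q x} = card {1..n}"
      by (subst card_Un_disjoint[symmetric]) auto
    then have "card {x \<in> {1..n}. Q x} + card {x \<in> {1..n}. \<not> Q x} = n" by simp
    from arg_cong[OF this, of "of_nat :: nat \<Rightarrow> complex"] show ?thesis
      by (simp only: of_nat_add eq_diff_eq)
  qed
  have "2 * W_char n \<sigma> = (of_nat n - of_nat (card M1)) ^ 2 - 4 * (of_nat n - of_nat (card M1))
    + (of_nat n - of_nat (card M2))"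
    using two_W_char_eq[OF n \<sigma>] by (simp only: card_fixed M1 M2)
  moreover have "W_char n \<sigma> = 2 * W_char n \<sigma> / 2" by simp
  ultimately show ?thesis by metis
qed

text \<open>\<sigma> maps the fixed points of the first composite to those of the second, and \<pi>
  maps them back.\<close>

lemma card_fixed_comp_commute:
  assumes "\<pi> permutes A" "\<sigma> permutes A"
  shows "card {x \<in> A. \<pi> (\<sigma> x) = x} = card {x \<in> A. \<sigma> (\<pi> x) = x}"
  by (rule bij_betw_same_card[of \<sigma>], rule bij_betw_byWitness[where f' = \<pi>])
    (use assms in \<open>auto simp: permutes_in_image\<close>)

lemma W_char_comp_commute:
  assumes n: "n \<ge> 3" and \<pi>: "\<pi> permutes {1..n}" and \<sigma>: "\<sigma> permutes {1..n}"
  shows "W_char n (\<pi> \<circ> \<sigma>) = W_char n (\<sigma> \<circ> \<pi>)"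
proof -
  have "2 * W_char n (\<pi> \<circ> \<sigma>) = 2 * W_char n (\<sigma> \<circ> \<pi>)"
    \<comment> \<open>The first instance handles f1. For f2 the square of \<pi>\<sigma> is split as
      \<pi>\<sigma>\<pi> times \<sigma>; exchanging these factors gives the square of
      \<sigma>\<pi>.\<close>
    using card_fixed_comp_commute[OF \<pi> \<sigma>]
      card_fixed_comp_commute[OF permutes_compose[OF \<pi> permutes_compose[OF \<sigma> \<pi>]] \<sigma>]
    unfolding two_W_char_eq[OF n permutes_compose[OF \<sigma> \<pi>]]
      two_W_char_eq[OF n permutes_compose[OF \<pi> \<sigma>]]
    by simp
  then show ?thesis by simp
qed

lemma W_char_inverse:
  assumes n: "n \<ge> 3" and \<sigma>: "\<sigma> permutes {1..n}"
  shows "W_char n (inv \<sigma>) = W_char n \<sigma>"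
proof -
  have "inv \<sigma> x = x \<longleftrightarrow> \<sigma> x = x" "inv \<sigma> (inv \<sigma> x) = x \<longleftrightarrow> \<sigma> (\<sigma> x) = x" for x
    using permutes_inverses[OF \<sigma>] by metis+
  then have "2 * W_char n (inv \<sigma>) = 2 * W_char n \<sigma>"
    using two_W_char_eq[OF n \<sigma>] two_W_char_eq[OF n permutes_inv[OF \<sigma>]] by simp
  then show ?thesis by simp
qed

text \<open>\<open>S\<close> and \<open>T\<close> list the vertices of the subgraph that are moved
  and those that return to their place, so only finitely many named points must be evaluated.
  \<open>T\<close> matters for squares, where 2-cycles become fixed points.\<close>

lemma moved_eqI:
  assumes "S \<subseteq> A" "\<forall>x\<in>S. f x \<noteq> x" "\<forall>x\<in>T. f x = x"
    and "\<forall>x. x \<notin> S \<union> T \<longrightarrow> f x = x"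
  shows "{x \<in> A. f x \<noteq> x} = S"
  using assms by blast

text \<open>Serves twice: for the orders of three given edges, and as the explicit fibre of size 6
  over a three-element set.\<close>

lemma triple_set_eq_iff:
  assumes "distinct [a, b, c]"
  shows "{a, b, c} = {x, y, z} \<longleftrightarrow>
    (x, y, z) \<in> {(a, b, c), (a, c, b), (b, a, c), (b, c, a), (c, a, b), (c, b, a)}"
proof
  assume eq: "{a, b, c} = {x, y, z}"
  have "card {x, y, z} = 3"
    using assms unfolding eq[symmetric] by simp
  then have "x \<noteq> y" "x \<noteq> z"
    by (auto simp: card_insert_if split: if_splits)
  then have rest: "{y, z} = {a, b, c} - {x}"
    unfolding eq by blast
  have "x \<in> {a, b, c}"
    unfolding eq by simp
  then consider "x = a" "{y, z} = {b, c}" | "x = b" "{y, z} = {a, c}" | "x = c" "{y, z} = {a, b}"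
    using rest assms by auto
  then show "(x, y, z) \<in> {(a, b, c), (a, c, b), (b, a, c), (b, c, a), (c, a, b), (c, b, a)}"
    by cases (auto simp: doubleton_eq_iff)
qed auto

definition triple_char :: "nat \<Rightarrow> nat set \<Rightarrow> nat set \<Rightarrow> nat set \<Rightarrow> complex"
  where "triple_char n e1 e2 e3 = W_char n (edge_transp e3 \<circ> edge_transp e2 \<circ> edge_transp e1)"

section \<open>Triples of edges: independence of the order, and values by shape\<close>

context
  fixes n :: nat
  assumes n: "n \<ge> 3"
begin

lemma triple_char_rotate:
  assumes "e1 \<in> [{1..n}]\<^bsup>2\<^esup>" "e2 \<in> [{1..n}]\<^bsup>2\<^esup>" "e3 \<in> [{1..n}]\<^bsup>2\<^esup>"
  shows "triple_char n e1 e2 e3 = triple_char n e2 e3 e1"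
  unfolding triple_char_def
  using W_char_comp_commute[OF n permutes_compose[OF edge_transp_permutes[OF assms(2)]
        edge_transp_permutes[OF assms(3)]] edge_transp_permutes[OF assms(1)]]
  by (simp add: o_assoc)

lemma triple_char_reverse:
  assumes "e1 \<in> [{1..n}]\<^bsup>2\<^esup>" "e2 \<in> [{1..n}]\<^bsup>2\<^esup>" "e3 \<in> [{1..n}]\<^bsup>2\<^esup>"
  shows "triple_char n e1 e2 e3 = triple_char n e3 e2 e1"
proof -
  let ?\<sigma> = "edge_transp e3 \<circ> edge_transp e2 \<circ> edge_transp e1"
  have perm: "?\<sigma> permutes {1..n}"
    by (intro permutes_compose edge_transp_permutes assms)
  have "inv ?\<sigma> = edge_transp e1 \<circ> edge_transp e2 \<circ> edge_transp e3"
    by (rule inv_unique_comp) (auto simp: fun_eq_iff)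
  then show ?thesis
    unfolding triple_char_def using W_char_inverse[OF n perm] by simp
qed

text \<open>Rotation and reversal generate all six orders of three edges, as the dihedral group of a
  triangle is the full symmetric group on its corners.\<close>

lemma triple_char_cong:
  assumes "e1 \<in> [{1..n}]\<^bsup>2\<^esup>" "e2 \<in> [{1..n}]\<^bsup>2\<^esup>" "e3 \<in> [{1..n}]\<^bsup>2\<^esup>"
    and "distinct [e1, e2, e3]" and "{e1, e2, e3} = {f1, f2, f3}"
  shows "triple_char n e1 e2 e3 = triple_char n f1 f2 f3"
proof -
  have eqs: "triple_char n e2 e3 e1 = triple_char n e1 e2 e3"
    "triple_char n e3 e1 e2 = triple_char n e1 e2 e3"
    "triple_char n e3 e2 e1 = triple_char n e1 e2 e3"
    "triple_char n e2 e1 e3 = triple_char n e1 e2 e3"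
    "triple_char n e1 e3 e2 = triple_char n e1 e2 e3"
    using triple_char_rotate[OF assms(1,2,3)] triple_char_rotate[OF assms(2,3,1)]
      triple_char_reverse[OF assms(1,2,3)] triple_char_reverse[OF assms(2,3,1)]
      triple_char_reverse[OF assms(3,1,2)]
    by simp_all
  then show ?thesis
    using assms(5) unfolding triple_set_eq_iff[OF assms(4)] by auto
qed

lemma W_char_transpose:
  assumes "distinct [a, b]" "{a, b} \<subseteq> {1..n}"
  shows "W_char n (transpose a b) = (of_nat n - 3) * (of_nat n - 4) / 2"
proof -
  have "{x \<in> {1..n}. transpose a b x \<noteq> x} = {a, b}"
    and "{x \<in> {1..n}. transpose a b (transpose a b x) \<noteq> x} = {}"
    using assms by (auto simp: transpose_def split: if_splits)
  note W_char_moved[OF n permutes_swap_id this]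
  then show ?thesis using assms by (simp add: field_simps power2_eq_square)
qed

text \<open>A rotation brings two equal edges to the front, where their transpositions cancel and
  leave the third edge.\<close>

lemma triple_char_repeat:
  assumes "e1 \<in> [{1..n}]\<^bsup>2\<^esup>" "e2 \<in> [{1..n}]\<^bsup>2\<^esup>" "e3 \<in> [{1..n}]\<^bsup>2\<^esup>"
    and "\<not> distinct [e1, e2, e3]"
  shows "triple_char n e1 e2 e3 = (of_nat n - 3) * (of_nat n - 4) / 2"
proof -
  have first: "triple_char n e e f = (of_nat n - 3) * (of_nat n - 4) / 2"
    if f: "f \<in> [{1..n}]\<^bsup>2\<^esup>" for e f
  proof -
    obtain a b where "f = {a, b}" "a \<noteq> b" "a \<in> {1..n}" "b \<in> {1..n}"
      by (rule pairE[OF f])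
    moreover have "edge_transp f \<circ> edge_transp e \<circ> edge_transp e = edge_transp f"
      by (simp add: fun_eq_iff)
    ultimately show ?thesis
      unfolding triple_char_def using W_char_transpose[of a b] by (simp only: edge_transp_pair) simp
  qed
  consider "e1 = e2" | "e2 = e3" | "e3 = e1" using assms(4) by auto
  then show ?thesis
    using first[OF assms(1)] first[OF assms(2)] first[OF assms(3)]
      triple_char_rotate[OF assms(1,2,3)] triple_char_rotate[OF assms(2,3,1)]
    by cases metis+
qed

lemma edge_comp_permutes:
  assumes "{a, b, c, d, e, f} \<subseteq> {1..n}"
  shows "transpose e f \<circ> transpose c d \<circ> transpose a b permutes {1..n}"
  using assms by (intro permutes_compose permutes_swap_id) auto

text \<open>Two edges of the triangle give a 3-cycle, which the third edge turns back into a
  transposition; so a triangle weighs as much as a triple with a repeated edge.\<close>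

lemma triple_char_triangle:
  assumes "distinct [a, b, c]" "{a, b, c} \<subseteq> {1..n}"
  shows "triple_char n {a, b} {b, c} {a, c} = (of_nat n - 3) * (of_nat n - 4) / 2"
proof -
  have "transpose a c \<circ> transpose b c \<circ> transpose a b = transpose b c"
    using assms(1) by (auto simp: fun_eq_iff transpose_def)
  then show ?thesis
    unfolding triple_char_def edge_transp_pair using W_char_transpose[of b c] assms by simp
qed

text \<open>Multiplying the transpositions along a tree on four vertices gives a 4-cycle; neither it
  nor its square fixes any of the four. The same holds for paths, whence the common
  constant.\<close>

lemma triple_char_star:
  assumes "distinct [a, b, c, d]" "{a, b, c, d} \<subseteq> {1..n}"
  shows "triple_char n {a, b} {a, c} {a, d} = (of_nat n ^ 2 - 11 * of_nat n + 28) / 2"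
proof -
  \<comment> \<open>Supplies the inequalities in the other orientation, so that \<open>simp\<close>
    can decide every test in the transpositions.\<close>
  have rev: "distinct [d, c, b, a]" using assms(1) by auto
  let ?\<sigma> = "transpose a d \<circ> transpose a c \<circ> transpose a b"
  have M: "{x \<in> {1..n}. ?\<sigma> x \<noteq> x} = {a, b, c, d}" "{x \<in> {1..n}. ?\<sigma> (?\<sigma> x) \<noteq> x} = {a, b, c, d}"
    by (rule moved_eqI[where T = "{}"]; use assms rev in simp)+
  have "?\<sigma> permutes {1..n}" using assms(2) by (intro edge_comp_permutes) auto
  note W_char_moved[OF n this M]
  then show ?thesis
    unfolding triple_char_def edge_transp_pair
    by (simp only:) (use assms(1) in \<open>simp add: field_simps power2_eq_square\<close>)
qed

lemma triple_char_path:
  assumes "distinct [a, b, c, d]" "{a, b, c, d} \<subseteq> {1..n}"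
  shows "triple_char n {a, b} {b, c} {c, d} = (of_nat n ^ 2 - 11 * of_nat n + 28) / 2"
proof -
  have rev: "distinct [d, c, b, a]" using assms(1) by auto
  let ?\<sigma> = "transpose c d \<circ> transpose b c \<circ> transpose a b"
  have M: "{x \<in> {1..n}. ?\<sigma> x \<noteq> x} = {a, b, c, d}" "{x \<in> {1..n}. ?\<sigma> (?\<sigma> x) \<noteq> x} = {a, b, c, d}"
    by (rule moved_eqI[where T = "{}"]; use assms rev in simp)+
  have "?\<sigma> permutes {1..n}" using assms(2) by (intro edge_comp_permutes) auto
  note W_char_moved[OF n this M]
  then show ?thesis
    unfolding triple_char_def edge_transp_pair
    by (simp only:) (use assms(1) in \<open>simp add: field_simps power2_eq_square\<close>)
qed

lemma triple_char_path_plus_edge: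
  assumes "distinct [a, b, c, d, e]" "{a, b, c, d, e} \<subseteq> {1..n}"
  shows "triple_char n {a, b} {b, c} {d, e} = (of_nat n ^ 2 - 13 * of_nat n + 42) / 2"
proof -
  have rev: "distinct [e, d, c, b, a]" using assms(1) by auto
  let ?\<sigma> = "transpose d e \<circ> transpose b c \<circ> transpose a b"
  have M1: "{x \<in> {1..n}. ?\<sigma> x \<noteq> x} = {a, b, c, d, e}"
    by (rule moved_eqI[where T = "{}"]; use assms rev in simp)
  \<comment> \<open>The permutation is a 3-cycle times a disjoint transposition; squaring kills the
    transposition and releases \<open>d\<close> and \<open>e\<close>.\<close>
  have M2: "{x \<in> {1..n}. ?\<sigma> (?\<sigma> x) \<noteq> x} = {a, b, c}"
    by (rule moved_eqI[where T = "{d, e}"]; use assms rev in simp)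
  have "?\<sigma> permutes {1..n}" using assms(2) by (intro edge_comp_permutes) auto
  note W_char_moved[OF n this M1 M2]
  then show ?thesis
    unfolding triple_char_def edge_transp_pair
    by (simp only:) (use assms(1) in \<open>simp add: field_simps power2_eq_square\<close>)
qed

lemma triple_char_matching:
  assumes "distinct [a, b, c, d, e, f]" "{a, b, c, d, e, f} \<subseteq> {1..n}"
  shows "triple_char n {a, b} {c, d} {e, f} = (of_nat n ^ 2 - 15 * of_nat n + 60) / 2"
proof -
  have rev: "distinct [f, e, d, c, b, a]" using assms(1) by auto
  let ?\<sigma> = "transpose e f \<circ> transpose c d \<circ> transpose a b"
  have M1: "{x \<in> {1..n}. ?\<sigma> x \<noteq> x} = {a, b, c, d, e, f}"
    by (rule moved_eqI[where T = "{}"]; use assms rev in simp)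
  \<comment> \<open>Three disjoint transpositions commute, so the product is an involution.\<close>
  have M2: "{x \<in> {1..n}. ?\<sigma> (?\<sigma> x) \<noteq> x} = {}"
    by (rule moved_eqI[where T = "{a, b, c, d, e, f}"]; use assms rev in simp)
  have "?\<sigma> permutes {1..n}" using assms(2) by (intro edge_comp_permutes) auto
  note W_char_moved[OF n this M1 M2]
  then show ?thesis
    unfolding triple_char_def edge_transp_pair
    by (simp only:) (use assms(1) in \<open>simp add: field_simps power2_eq_square\<close>)
qed

end

section \<open>Three-edge subgraphs\<close>

lemma intersecting_pairsE:
  assumes "p \<in> [A]\<^bsup>2\<^esup>" "q \<in> [A]\<^bsup>2\<^esup>" "p \<noteq> q" "\<not> disjnt p q"
  obtains a b c where "distinct [a, b, c]" "p = {a, b}" "q = {b, c}"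
proof -
  obtain b where b: "b \<in> p" "b \<in> q"
    using assms(4) by (auto simp: disjnt_def)
  have other: "\<exists>a. r = {a, b} \<and> a \<noteq> b" if "r \<in> [A]\<^bsup>2\<^esup>" "b \<in> r" for r
    using that(1)
  proof (rule pairE)
    fix x y assume "r = {x, y}" "x \<noteq> y"
    then show ?thesis using that(2) by (auto simp: insert_commute)
  qed
  obtain a c where "p = {a, b}" "a \<noteq> b" "q = {c, b}" "c \<noteq> b"
    using other assms(1,2) b by blast
  with assms(3) show ?thesis
    by (intro that[of a b c]) (auto simp: insert_commute)
qed

text \<open>Unless the edges are pairwise disjoint, two of them form a path a-b-c, and the third has
  two, one or no ends on it: a triangle; a star or a path, depending on whether it hangs at the
  middle \<open>b\<close> or at an end; or a separate edge.\<close>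

lemma three_pairs_cases:
  assumes F: "F \<subseteq> [A]\<^bsup>2\<^esup>" and card_F: "card F = 3"
  obtains
    (triangle) a b c where "distinct [a, b, c]" "F = {{a, b}, {b, c}, {a, c}}"
  | (star) a b c d where "distinct [a, b, c, d]" "F = {{a, b}, {a, c}, {a, d}}"
  | (path) a b c d where "distinct [a, b, c, d]" "F = {{a, b}, {b, c}, {c, d}}"
  | (path_plus_edge) a b c d e where "distinct [a, b, c, d, e]" "F = {{a, b}, {b, c}, {d, e}}"
  | (matching) a b c d e f where "distinct [a, b, c, d, e, f]" "F = {{a, b}, {c, d}, {e, f}}"
proof (cases "pairwise disjnt F")
  case True
  obtain p q r where F_eq: "F = {p, q, r}" and neq: "p \<noteq> q" "q \<noteq> r" "p \<noteq> r"
    using card_F card_3_iff[of F] by blast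
  have disj: "p \<inter> q = {}" "q \<inter> r = {}" "p \<inter> r = {}"
    using True neq unfolding F_eq pairwise_insert disjnt_def by auto
  have mem: "p \<in> [A]\<^bsup>2\<^esup>" "q \<in> [A]\<^bsup>2\<^esup>" "r \<in> [A]\<^bsup>2\<^esup>"
    using F unfolding F_eq by auto
  obtain a b where p: "p = {a, b}" "a \<noteq> b" by (rule pairE[OF mem(1)])
  obtain c d where q: "q = {c, d}" "c \<noteq> d" by (rule pairE[OF mem(2)])
  obtain e f where r: "r = {e, f}" "e \<noteq> f" by (rule pairE[OF mem(3)])
  show thesis
    by (rule matching[of a b c d e f]) (use disj p q r F_eq in auto)
next
  case False
  then obtain p q where pq: "p \<in> F" "q \<in> F" "p \<noteq> q" "\<not> disjnt p q"
    by (auto simp: pairwise_def)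
  obtain a b c where abc: "distinct [a, b, c]" "p = {a, b}" "q = {b, c}"
    using intersecting_pairsE[OF _ _ pq(3,4), of A thesis] pq(1,2) F by blast
  have "card (F - {p, q}) = 1"
    using pq card_F by (subst card_Diff_subset) auto
  then obtain r where "F - {p, q} = {r}"
    by (rule card_1_singletonE)
  then have F_eq: "F = {p, q, r}" and r: "r \<noteq> p" "r \<noteq> q" "r \<in> F"
    using pq by auto
  obtain d e where de: "r = {d, e}" "d \<noteq> e"
    using F r(3) pairE[of r A thesis] by blast
  have attached: thesis if xy: "r = {x, y}" "x \<in> {a, b, c}" "y \<notin> {a, b, c}" for x y
  proof -
    consider "x = a" | "x = b" | "x = c" using xy(2) by blast
    then show thesis
    proof cases
      case 1
      show thesis
        by (rule path[of y a b c]) (use 1 xy abc F_eq in \<open>auto simp: insert_commute\<close>)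
    next
      case 2
      show thesis
        by (rule star[of b a c y]) (use 2 xy abc F_eq in \<open>auto simp: insert_commute\<close>)
    next
      case 3
      show thesis
        by (rule path[of a b c y]) (use 3 xy abc F_eq in \<open>auto simp: insert_commute\<close>)
    qed
  qed
  consider "d \<in> {a, b, c}" "e \<in> {a, b, c}" | "d \<in> {a, b, c}" "e \<notin> {a, b, c}"
    | "d \<notin> {a, b, c}" "e \<in> {a, b, c}" | "d \<notin> {a, b, c}" "e \<notin> {a, b, c}"
    by blast
  then show thesis
  proof cases
    case 1
    \<comment> \<open>The other two pairs inside \<open>{a, b, c}\<close> are already
      \<open>p\<close> and \<open>q\<close>.\<close>
    then have "r = {a, c}"
      using de r(1,2) abc(2,3) by (auto simp: doubleton_eq_iff)
    then show thesis
      using triangle[OF abc(1)] F_eq abc(2,3) by simp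
  next
    case 2
    then show thesis using attached de by blast
  next
    case 3
    then show thesis using attached[of e d] de by (simp add: insert_commute)
  next
    case 4
    show thesis
      by (rule path_plus_edge[of a b c d e]) (use 4 de abc F_eq in auto)
  qed
qed

lemma triangle_cards:
  assumes "distinct [a, b, c]"
  shows "card {{a, b}, {b, c}, {a, c}} = 3" "card (\<Union>{{a, b}, {b, c}, {a, c}}) = 3"
  using assms by (auto simp: card_insert_if doubleton_eq_iff)

lemma star_cards:
  assumes "distinct [a, b, c, d]"
  shows "card {{a, b}, {a, c}, {a, d}} = 3" "card (\<Union>{{a, b}, {a, c}, {a, d}}) = 4"
  using assms by (auto simp: card_insert_if doubleton_eq_iff)

lemma path_cards:
  assumes "distinct [a, b, c, d]"
  shows "card {{a, b}, {b, c}, {c, d}} = 3" "card (\<Union>{{a, b}, {b, c}, {c, d}}) = 4"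
  using assms by (auto simp: card_insert_if doubleton_eq_iff)

lemma path_plus_edge_cards:
  assumes "distinct [a, b, c, d, e]"
  shows "card {{a, b}, {b, c}, {d, e}} = 3" "card (\<Union>{{a, b}, {b, c}, {d, e}}) = 5"
  using assms by (auto simp: card_insert_if doubleton_eq_iff)

lemma matching_cards:
  assumes "distinct [a, b, c, d, e, f]"
  shows "card {{a, b}, {c, d}, {e, f}} = 3" "card (\<Union>{{a, b}, {c, d}, {e, f}}) = 6"
  using assms by (auto simp: card_insert_if doubleton_eq_iff)

lemmas shape_cards = triangle_cards star_cards path_cards path_plus_edge_cards matching_cards

section \<open>Counting three-edge sets by the number of vertices they cover\<close>

lemma nsets_3_iff: "F \<in> [E]\<^bsup>3\<^esup> \<longleftrightarrow> F \<subseteq> E \<and> card F = 3"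
  by (auto simp: nsets_def intro: card_ge_0_finite)

lemma card_Union_three_pairs:
  assumes "E \<subseteq> [A]\<^bsup>2\<^esup>" "F \<in> [E]\<^bsup>3\<^esup>"
  shows "card (\<Union>F) \<in> {3, 4, 5, 6}"
proof -
  have "F \<subseteq> [A]\<^bsup>2\<^esup>" "card F = 3" using assms by (auto simp: nsets_3_iff)
  then show ?thesis
    by (cases rule: three_pairs_cases) (simp_all only: shape_cards insert_iff simp_thms)
qed

text \<open>\<open>triangles\<close> counts vertex sets, whereas the sum runs over edge sets; taking
  all pairs and taking the union are mutually inverse.\<close>

lemma card_triangles:
  assumes E: "E \<subseteq> [A]\<^bsup>2\<^esup>"
  shows "card {F \<in> [E]\<^bsup>3\<^esup>. card (\<Union>F) = 3} = triangles E"
proof -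
  have pairs: "[{a, b, c}]\<^bsup>2\<^esup> = {{a, b}, {b, c}, {a, c}}" if "distinct [a, b, c]" for a b c :: nat
    using that by (auto simp: nsets_2_eq insert_commute)
  have obt: "\<exists>a b c. distinct [a, b, c] \<and> T = {a, b, c}" if "card T = 3" for T :: "nat set"
    using that unfolding card_3_iff by auto
  have Union_pairs: "\<Union>([T]\<^bsup>2\<^esup>) = T" if T: "card T = 3" for T :: "nat set"
  proof -
    obtain a b c where "distinct [a, b, c]" "T = {a, b, c}" using obt[OF T] by blast
    then show ?thesis using pairs[of a b c] by auto
  qed
  have "bij_betw (\<lambda>T. [T]\<^bsup>2\<^esup>) {T. card T = 3 \<and> [T]\<^bsup>2\<^esup> \<subseteq> E} {F \<in> [E]\<^bsup>3\<^esup>. card (\<Union>F) = 3}"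
  proof (rule bij_betw_byWitness[where f' = Union])
    show "\<forall>T\<in>{T. card T = 3 \<and> [T]\<^bsup>2\<^esup> \<subseteq> E}. \<Union>([T]\<^bsup>2\<^esup>) = T"
      using Union_pairs by blast
    show "(\<lambda>T. [T]\<^bsup>2\<^esup>) ` {T. card T = 3 \<and> [T]\<^bsup>2\<^esup> \<subseteq> E} \<subseteq> {F \<in> [E]\<^bsup>3\<^esup>. card (\<Union>F) = 3}"
      using Union_pairs by (auto simp: nsets_3_iff card_nsets choose_two)
    have shape: "\<exists>a b c. distinct [a, b, c] \<and> F = {{a, b}, {b, c}, {a, c}}"
      if "F \<in> [E]\<^bsup>3\<^esup>" "card (\<Union>F) = 3" for F
    proof -
      have "F \<subseteq> [A]\<^bsup>2\<^esup>" "card F = 3" using that E by (auto simp: nsets_3_iff)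
      then show ?thesis
      proof (cases rule: three_pairs_cases)
        case triangle
        then show ?thesis by blast
      qed (use that(2) in \<open>simp_all only: shape_cards numeral_eq_iff num.distinct num.inject\<close>)
    qed
    have inverse: "[\<Union>F]\<^bsup>2\<^esup> = F" if F: "F \<in> [E]\<^bsup>3\<^esup>" "card (\<Union>F) = 3" for F
    proof -
      obtain a b c where abc: "distinct [a, b, c]" "F = {{a, b}, {b, c}, {a, c}}"
        using shape[OF F] by blast
      then have "\<Union>F = {a, b, c}" by auto
      then show ?thesis using pairs[OF abc(1)] abc(2) by simp
    qed
    then show "\<forall>F\<in>{F \<in> [E]\<^bsup>3\<^esup>. card (\<Union>F) = 3}. [\<Union>F]\<^bsup>2\<^esup> = F"
      by blast
    show "Union ` {F \<in> [E]\<^bsup>3\<^esup>. card (\<Union>F) = 3} \<subseteq> {T. card T = 3 \<and> [T]\<^bsup>2\<^esup> \<subseteq> E}"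
      using inverse by (auto simp: nsets_3_iff)
  qed
  then show ?thesis
    unfolding triangles_def by (rule bij_betw_same_card[symmetric])
qed

text \<open>The centre of a three-edge star is unique: an edge through two vertices is determined by
  them, so three distinct edges share at most one. The stars are therefore partitioned by centre,
  and each centre contributes a binomial coefficient of its degree.\<close>

lemma card_stars:
  assumes E: "E \<subseteq> [{1..n}]\<^bsup>2\<^esup>"
  shows "card {F \<in> [E]\<^bsup>3\<^esup>. \<exists>v. \<forall>e\<in>F. v \<in> e} = stars n E"
proof -
  have fin: "finite E" using E finite_subset finite_imp_finite_nsets by blast
  let ?S = "\<lambda>v. [{e \<in> E. v \<in> e}]\<^bsup>3\<^esup>"
  have disj: "?S v \<inter> ?S w = {}" if "v \<noteq> w" for v w
  proof -
    have False if F: "F \<in> ?S v" "F \<in> ?S w" for F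
    proof -
      have "e = {v, w}" if "e \<in> F" for e
      proof -
        have "e \<in> [{1..n}]\<^bsup>2\<^esup>" "v \<in> e" "w \<in> e" using F that E by (auto simp: nsets_3_iff)
        then show ?thesis using \<open>v \<noteq> w\<close> by (auto elim!: pairE)
      qed
      then have "F \<subseteq> {{v, w}}" by blast
      then have "card F \<le> card {{v, w}}" by (intro card_mono) auto
      then show False using F by (simp add: nsets_3_iff)
    qed
    then show ?thesis by blast
  qed
  have "{F \<in> [E]\<^bsup>3\<^esup>. \<exists>v. \<forall>e\<in>F. v \<in> e} = (\<Union>v\<in>{1..n}. ?S v)"
  proof (intro set_eqI iffI)
    fix F assume "F \<in> {F \<in> [E]\<^bsup>3\<^esup>. \<exists>v. \<forall>e\<in>F. v \<in> e}"
    then obtain v where v: "F \<subseteq> E" "card F = 3" "\<forall>e\<in>F. v \<in> e" by (auto simp: nsets_3_iff)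
    then obtain e where "e \<in> F" by fastforce
    then have "v \<in> e" "e \<in> [{1..n}]\<^bsup>2\<^esup>" using v E by auto
    then have "v \<in> {1..n}" unfolding nsets_def by blast
    moreover have "F \<in> ?S v" using v by (auto simp: nsets_3_iff)
    ultimately show "F \<in> (\<Union>v\<in>{1..n}. ?S v)" by blast
  qed (auto simp: nsets_3_iff)
  then have "card {F \<in> [E]\<^bsup>3\<^esup>. \<exists>v. \<forall>e\<in>F. v \<in> e} = (\<Sum>v\<in>{1..n}. card (?S v))"
    using disj fin by (simp add: card_UN_disjoint finite_imp_finite_nsets)
  then show ?thesis
    by (simp add: stars_def degree_def card_nsets)
qed

lemma card_stars_paths:
  assumes E: "E \<subseteq> [{1..n}]\<^bsup>2\<^esup>"
  shows "card {F \<in> [E]\<^bsup>3\<^esup>. card (\<Union>F) = 4} = stars n E + paths E"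
proof -
  have fin: "finite E" using E finite_subset finite_imp_finite_nsets by blast
  let ?path = "\<lambda>F. \<exists>a b c d. distinct [a, b, c, d] \<and> F = {{a, b}, {b, c}, {c, d :: nat}}"
  let ?star = "\<lambda>F. \<exists>v :: nat. \<forall>e\<in>F. v \<in> e"
  have not_both: "\<not> ?star F" if "?path F" for F
    using that by (elim exE conjE) (simp, blast)
  have iff: "card (\<Union>F) = 4 \<longleftrightarrow> ?star F \<or> ?path F" if "F \<in> [E]\<^bsup>3\<^esup>" for F
  proof -
    have "F \<subseteq> [{1..n}]\<^bsup>2\<^esup>" "card F = 3" using that E by (auto simp: nsets_3_iff)
    then show ?thesis
    proof (cases rule: three_pairs_cases)
      case (triangle a b c)
      then have "\<not> ?star F" by auto
      moreover have "\<not> ?path F" using triangle_cards(2)[OF triangle(1)] triangle(2) path_cards(2)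
        by (metis numeral_eq_iff num.distinct num.inject)
      ultimately show ?thesis using triangle_cards(2)[OF triangle(1)] triangle(2) by simp
    next
      case (star a b c d)
      then have "?star F" by auto
      then show ?thesis using star_cards(2)[OF star(1)] star(2) by simp
    next
      case (path a b c d)
      then have "?path F" by blast
      then show ?thesis using path_cards(2)[OF path(1)] path(2) by simp
    next
      case (path_plus_edge a b c d e)
      then have "\<not> ?star F" by auto
      moreover have "\<not> ?path F"
        using path_plus_edge_cards(2)[OF path_plus_edge(1)] path_plus_edge(2) path_cards(2)
        by (metis numeral_eq_iff num.distinct num.inject)
      ultimately show ?thesis
        using path_plus_edge_cards(2)[OF path_plus_edge(1)] path_plus_edge(2) by simp
    next
      case (matching a b c d e f)
      then have "\<not> ?star F" by auto
      moreover have "\<not> ?path F"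
        using matching_cards(2)[OF matching(1)] matching(2) path_cards(2)
        by (metis numeral_eq_iff num.distinct num.inject)
      ultimately show ?thesis
        using matching_cards(2)[OF matching(1)] matching(2) by simp
    qed
  qed
  \<comment> \<open>Naming the two predicates keeps the automation from opening their quantifiers
    during the set algebra.\<close>
  define P where "P = (\<lambda>F. ?path F)"
  define S where "S = (\<lambda>F. ?star F)"
  have path_card: "card F = 3" if "P F" for F
    using that path_cards(1) unfolding P_def by (elim exE conjE) simp
  have "card (\<Union>F) = 4 \<longleftrightarrow> S F \<or> P F" if "F \<in> [E]\<^bsup>3\<^esup>" for F
    using iff[OF that] by (simp only: S_def P_def)
  then have "{F \<in> [E]\<^bsup>3\<^esup>. card (\<Union>F) = 4} = {F \<in> [E]\<^bsup>3\<^esup>. S F} \<union> {F \<in> [E]\<^bsup>3\<^esup>. P F}"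
    by blast
  \<comment> \<open>\<open>paths\<close> does not ask for three edges; this follows from the
    distinctness of the four vertices.\<close>
  moreover have "{F \<in> [E]\<^bsup>3\<^esup>. P F} = {F. F \<subseteq> E \<and> P F}"
    unfolding nsets_3_iff using path_card by blast
  moreover have "\<not> S F" if "P F" for F
    using that unfolding S_def P_def by (rule not_both)
  then have "{F \<in> [E]\<^bsup>3\<^esup>. S F} \<inter> {F \<in> [E]\<^bsup>3\<^esup>. P F} = {}"
    by blast
  moreover have "card {F. F \<subseteq> E \<and> P F} = paths E" "card {F \<in> [E]\<^bsup>3\<^esup>. S F} = stars n E"
    unfolding P_def S_def paths_def card_stars[OF E, symmetric] by (rule refl)+
  ultimately show ?thesis
    using fin by (simp add: card_Un_disjoint finite_imp_finite_nsets)
qed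

lemma card_path_plus_edges:
  assumes E: "E \<subseteq> [A]\<^bsup>2\<^esup>"
  shows "card {F \<in> [E]\<^bsup>3\<^esup>. card (\<Union>F) = 5} = path_plus_edges E"
proof -
  have "F \<in> [E]\<^bsup>3\<^esup> \<and> card (\<Union>F) = 5 \<longleftrightarrow> F \<subseteq> E \<and>
    (\<exists>a b c d e. distinct [a, b, c, d, e] \<and> F = {{a, b}, {b, c}, {d, e}})" for F
  proof
    assume F: "F \<in> [E]\<^bsup>3\<^esup> \<and> card (\<Union>F) = 5"
    then have "F \<subseteq> [A]\<^bsup>2\<^esup>" "card F = 3" using E by (auto simp: nsets_3_iff)
    then have "\<exists>a b c d e. distinct [a, b, c, d, e] \<and> F = {{a, b}, {b, c}, {d, e}}"
    proof (cases rule: three_pairs_cases)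
      case path_plus_edge
      then show ?thesis by blast
    qed (use F in \<open>simp_all only: shape_cards numeral_eq_iff num.distinct num.inject simp_thms\<close>)
    then show "F \<subseteq> E \<and> (\<exists>a b c d e. distinct [a, b, c, d, e] \<and> F = {{a, b}, {b, c}, {d, e}})"
      using F by (simp add: nsets_3_iff)
  next
    assume "F \<subseteq> E \<and> (\<exists>a b c d e. distinct [a, b, c, d, e] \<and> F = {{a, b}, {b, c}, {d, e}})"
    then show "F \<in> [E]\<^bsup>3\<^esup> \<and> card (\<Union>F) = 5"
      by (elim exE conjE) (simp only: nsets_3_iff path_plus_edge_cards simp_thms)
  qed
  then show ?thesis by (simp only: path_plus_edges_def)
qed

lemma card_matchings:
  assumes E: "E \<subseteq> [A]\<^bsup>2\<^esup>"
  shows "card {F \<in> [E]\<^bsup>3\<^esup>. card (\<Union>F) = 6} = three_matchings E"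
proof -
  have "card (\<Union>F) = 6 \<longleftrightarrow> pairwise disjnt F" if "F \<in> [E]\<^bsup>3\<^esup>" for F
  proof -
    have F: "F \<subseteq> [A]\<^bsup>2\<^esup>" "card F = 3" using that E by (auto simp: nsets_3_iff)
    have not_disjnt: "\<not> pairwise disjnt F" if "p \<in> F" "q \<in> F" "p \<noteq> q" "b \<in> p" "b \<in> q" for p q b
      using that by (auto simp: pairwise_def disjnt_def)
    show ?thesis
      using F
    proof (cases rule: three_pairs_cases)
      case (triangle a b c)
      then have "\<not> pairwise disjnt F"
        by (intro not_disjnt[of "{a, b}" "{b, c}" b]) (auto simp: doubleton_eq_iff)
      then show ?thesis using triangle_cards(2)[OF triangle(1)] triangle(2) by simp
    next
      case (star a b c d)
      then have "\<not> pairwise disjnt F"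
        by (intro not_disjnt[of "{a, b}" "{a, c}" a]) (auto simp: doubleton_eq_iff)
      then show ?thesis using star_cards(2)[OF star(1)] star(2) by simp
    next
      case (path a b c d)
      then have "\<not> pairwise disjnt F"
        by (intro not_disjnt[of "{a, b}" "{b, c}" b]) (auto simp: doubleton_eq_iff)
      then show ?thesis using path_cards(2)[OF path(1)] path(2) by simp
    next
      case (path_plus_edge a b c d e)
      then have "\<not> pairwise disjnt F"
        by (intro not_disjnt[of "{a, b}" "{b, c}" b]) (auto simp: doubleton_eq_iff)
      then show ?thesis
        using path_plus_edge_cards(2)[OF path_plus_edge(1)] path_plus_edge(2) by simp
    next
      case (matching a b c d e f)
      then have "pairwise disjnt F" by (auto simp: pairwise_insert disjnt_def)
      then show ?thesis using matching_cards(2)[OF matching(1)] matching(2) by simp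
    qed
  qed
  then have "{F \<in> [E]\<^bsup>3\<^esup>. card (\<Union>F) = 6} = {F. F \<subseteq> E \<and> card F = 3 \<and> pairwise disjnt F}"
    unfolding nsets_3_iff by blast
  then show ?thesis by (simp only: three_matchings_def)
qed

section \<open>Summation over triples\<close>

definition distinct_triples :: "'a set \<Rightarrow> ('a \<times> 'a \<times> 'a) set"
  where "distinct_triples X = {(a, b, c) \<in> X \<times> X \<times> X. distinct [a, b, c]}"

lemma sum_distinct_triples:
  fixes k :: "'a set \<Rightarrow> complex"
  assumes X: "finite X"
  shows "(\<Sum>(a, b, c)\<in>distinct_triples X. k {a, b, c}) = 6 * (\<Sum>F\<in>[X]\<^bsup>3\<^esup>. k F)"
proof -
  let ?D = "distinct_triples X"
  define g :: "'a \<times> 'a \<times> 'a \<Rightarrow> 'a set" where "g = (\<lambda>(a, b, c). {a, b, c})"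
  have fin: "finite ?D"
    unfolding distinct_triples_def by (rule finite_subset[of _ "X \<times> X \<times> X"]) (use X in auto)
  have img: "g ` ?D \<subseteq> [X]\<^bsup>3\<^esup>"
    by (auto simp: g_def distinct_triples_def nsets_def)
  have fibre: "card {x \<in> ?D. g x = F} = 6" if F: "F \<in> [X]\<^bsup>3\<^esup>" for F
  proof -
    have "card F = 3" "F \<subseteq> X" using F by (auto simp: nsets_def)
    then obtain a b c where abc: "distinct [a, b, c]" "F = {a, b, c}"
      unfolding card_3_iff by auto
    have "{x \<in> ?D. g x = F} =
        {(a, b, c), (a, c, b), (b, a, c), (b, c, a), (c, a, b), (c, b, a)}" (is "_ = ?P")
    proof (rule set_eqI)
      fix x :: "'a \<times> 'a \<times> 'a"
      obtain u v w where x: "x = (u, v, w)" by (cases x)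
      have "g x = F \<longleftrightarrow> x \<in> ?P"
        unfolding x g_def abc(2) prod.case triple_set_eq_iff[OF abc(1), symmetric]
        by (rule eq_commute)
      moreover have "x \<in> ?P \<Longrightarrow> x \<in> ?D"
        using abc \<open>F \<subseteq> X\<close> by (auto simp: distinct_triples_def)
      ultimately show "x \<in> {x \<in> ?D. g x = F} \<longleftrightarrow> x \<in> ?P" by blast
    qed
    moreover have "card ?P = 6" using abc(1) by simp
    ultimately show ?thesis by simp
  qed
  have "(\<Sum>(a, b, c)\<in>?D. k {a, b, c}) = (\<Sum>x\<in>?D. k (g x))"
    by (intro sum.cong refl) (auto simp: g_def)
  also have "\<dots> = (\<Sum>F\<in>[X]\<^bsup>3\<^esup>. \<Sum>x\<in>{x \<in> ?D. g x = F}. k (g x))"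
    by (rule sum.group[symmetric]) (use fin img X in \<open>auto simp: finite_imp_finite_nsets\<close>)
  also have "\<dots> = (\<Sum>F\<in>[X]\<^bsup>3\<^esup>. 6 * k F)"
    by (intro sum.cong refl) (simp add: fibre)
  finally show ?thesis by (simp add: sum_distrib_left)
qed

text \<open>Pascal's rule reduces the induction step to the binomial coefficient over 2. The
  subtractions are complex, so the identity also covers m < 3 without truncation.\<close>

lemma of_nat_choose_3: "6 * of_nat (m choose 3) = of_nat m * (of_nat m - 1) * (of_nat m - 2 :: complex)"
proof (induction m)
  case (Suc m)
  have "2 * of_nat (m choose 2) = of_nat m * (of_nat m - 1 :: complex)"
    by (induction m) (simp_all add: numeral_2_eq_2 algebra_simps)
  then have "6 * of_nat (m choose 2) = 3 * (of_nat m * (of_nat m - 1 :: complex))"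
    by simp
  moreover have "(of_nat (Suc m choose 3) :: complex) = of_nat (m choose 2) + of_nat (m choose 3)"
    by (simp add: numeral_3_eq_3 numeral_2_eq_2)
  ultimately have "6 * of_nat (Suc m choose 3) =
      3 * (of_nat m * (of_nat m - 1)) + of_nat m * (of_nat m - 1) * (of_nat m - 2 :: complex)"
    by (simp only: distrib_left Suc.IH)
  then show ?case by (simp add: algebra_simps)
qed simp

text \<open>Three distinct edges form a triangle, a star or path, a path plus an edge, or a matching
  according to whether they cover 3, 4, 5 or 6 vertices.\<close>
definition three_edges_char :: "nat \<Rightarrow> nat set set \<Rightarrow> complex"
  where "three_edges_char n F =
    (if card (\<Union>F) = 3 then (of_nat n - 3) * (of_nat n - 4) / 2
     else if card (\<Union>F) = 4 then (of_nat n ^ 2 - 11 * of_nat n + 28) / 2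
     else if card (\<Union>F) = 5 then (of_nat n ^ 2 - 13 * of_nat n + 42) / 2
     else (of_nat n ^ 2 - 15 * of_nat n + 60) / 2)"

lemma triple_char_distinct:
  assumes n: "n \<ge> 3" and mem: "e1 \<in> [{1..n}]\<^bsup>2\<^esup>" "e2 \<in> [{1..n}]\<^bsup>2\<^esup>" "e3 \<in> [{1..n}]\<^bsup>2\<^esup>"
    and dist: "distinct [e1, e2, e3]"
  shows "triple_char n e1 e2 e3 = three_edges_char n {e1, e2, e3}"
proof -
  define F where "F = {e1, e2, e3}"
  have F: "F \<subseteq> [{1..n}]\<^bsup>2\<^esup>" "card F = 3"
    using mem dist by (auto simp: F_def)
  have verts: "\<Union>F \<subseteq> {1..n}"
    using F(1) by (auto simp: nsets_def)
  \<comment> \<open>Whatever canonical listing of \<open>F\<close> a shape provides,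
    \<open>eq\<close> transfers the value of \<open>triple_char\<close> from that listing to the
    given order of the edges.\<close>
  note eq = triple_char_cong[OF n mem dist F_def[symmetric, THEN trans]]
  have "triple_char n e1 e2 e3 = three_edges_char n F"
    using F
  proof (cases rule: three_pairs_cases)
    case (triangle a b c)
    have "{a, b, c} \<subseteq> {1..n}" using verts triangle(2) by auto
    then show ?thesis
      using eq[OF triangle(2)] triple_char_triangle[OF n triangle(1)]
        triangle_cards(2)[OF triangle(1)] triangle(2)
      by (simp only: three_edges_char_def if_True simp_thms)
  next
    case (star a b c d)
    have "{a, b, c, d} \<subseteq> {1..n}" using verts star(2) by auto
    then show ?thesis
      using eq[OF star(2)] triple_char_star[OF n star(1)]
        star_cards(2)[OF star(1)] star(2)
      by (simp add: three_edges_char_def)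
  next
    case (path a b c d)
    have "{a, b, c, d} \<subseteq> {1..n}" using verts path(2) by auto
    then show ?thesis
      using eq[OF path(2)] triple_char_path[OF n path(1)]
        path_cards(2)[OF path(1)] path(2)
      by (simp add: three_edges_char_def)
  next
    case (path_plus_edge a b c d e)
    have "{a, b, c, d, e} \<subseteq> {1..n}" using verts path_plus_edge(2) by auto
    then show ?thesis
      using eq[OF path_plus_edge(2)] triple_char_path_plus_edge[OF n path_plus_edge(1)]
        path_plus_edge_cards(2)[OF path_plus_edge(1)] path_plus_edge(2)
      by (simp add: three_edges_char_def)
  next
    case (matching a b c d e f)
    have "{a, b, c, d, e, f} \<subseteq> {1..n}" using verts matching(2) by auto
    then show ?thesis
      using eq[OF matching(2)] triple_char_matching[OF n matching(1)]
        matching_cards(2)[OF matching(1)] matching(2)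
      by (simp add: three_edges_char_def)
  qed
  then show ?thesis by (simp only: F_def)
qed

lemma M32_eq_three_edges_sum:
  assumes n: "n \<ge> 4" and E: "E \<subseteq> [{1..n}]\<^bsup>2\<^esup>"
  defines "m \<equiv> of_nat (card E)"
  shows "M32 n E = (of_nat n - 3) * (of_nat n - 4) / 2 * (m + 3 * m * (m - 1))
    + 6 * (\<Sum>F\<in>[E]\<^bsup>3\<^esup>. three_edges_char n F)"
proof -
  let ?c = "(of_nat n - 3) * (of_nat n - 4) / 2 :: complex" and ?D = "distinct_triples E"
  have fin: "finite E" using E finite_subset finite_imp_finite_nsets by blast
  have D: "?D \<subseteq> E \<times> E \<times> E" by (auto simp: distinct_triples_def)
  have n3: "n \<ge> 3" using n by simp
  have "of_nat (card ?D) = (\<Sum>(a, b, c)\<in>?D. 1 :: complex)"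
    by (simp add: case_prod_unfold)
  also have "\<dots> = 6 * of_nat (card E choose 3)"
    using sum_distinct_triples[OF fin, of "\<lambda>_. 1"] by (simp add: card_nsets)
  finally have card_D: "of_nat (card ?D) = m * (m - 1) * (m - 2)"
    unfolding of_nat_choose_3 m_def .
  have "card (E \<times> E \<times> E - ?D) + card ?D = card (E \<times> E \<times> E)"
    using card_Diff_subset[OF finite_subset[OF D] D] card_mono[OF _ D] fin by simp
  then have "of_nat (card (E \<times> E \<times> E - ?D)) + of_nat (card ?D) = (of_nat (card (E \<times> E \<times> E)) :: complex)"
    by (simp only: flip: of_nat_add)
  then have card_rest: "of_nat (card (E \<times> E \<times> E - ?D)) = m + 3 * m * (m - 1)"
    unfolding card_D by (simp add: card_cartesian_product m_def algebra_simps)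
  have "M32 n E = (\<Sum>(e1, e2, e3)\<in>E \<times> E \<times> E. triple_char n e1 e2 e3)"
    unfolding M32_eq_sum_W_char[OF n E] triple_char_def[symmetric]
    by (simp add: sum.cartesian_product case_prod_unfold)
  also have "\<dots> = (\<Sum>(e1, e2, e3)\<in>E \<times> E \<times> E - ?D. triple_char n e1 e2 e3)
      + (\<Sum>(e1, e2, e3)\<in>?D. triple_char n e1 e2 e3)"
    by (rule sum.subset_diff[OF D]) (use fin in simp)
  also have "(\<Sum>(e1, e2, e3)\<in>E \<times> E \<times> E - ?D. triple_char n e1 e2 e3) = (\<Sum>x\<in>E \<times> E \<times> E - ?D. ?c)"
  proof (rule sum.cong[OF refl])
    fix x assume x: "x \<in> E \<times> E \<times> E - ?D"
    obtain e1 e2 e3 where x_eq: "x = (e1, e2, e3)" by (cases x)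
    then have "e1 \<in> E" "e2 \<in> E" "e3 \<in> E" "\<not> distinct [e1, e2, e3]"
      using x by (auto simp: distinct_triples_def)
    then have "triple_char n e1 e2 e3 = ?c"
      using E by (intro triple_char_repeat[OF n3]) auto
    then show "(case x of (e1, e2, e3) \<Rightarrow> triple_char n e1 e2 e3) = ?c"
      by (simp add: x_eq)
  qed
  also have "(\<Sum>(e1, e2, e3)\<in>?D. triple_char n e1 e2 e3) =
      (\<Sum>(e1, e2, e3)\<in>?D. three_edges_char n {e1, e2, e3})"
  proof (rule sum.cong[OF refl])
    fix x assume x: "x \<in> ?D"
    obtain e1 e2 e3 where x_eq: "x = (e1, e2, e3)" by (cases x)
    then have "e1 \<in> E" "e2 \<in> E" "e3 \<in> E" "distinct [e1, e2, e3]"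
      using x by (auto simp: distinct_triples_def)
    then have "triple_char n e1 e2 e3 = three_edges_char n {e1, e2, e3}"
      using E by (intro triple_char_distinct[OF n3]) auto
    then show "(case x of (e1, e2, e3) \<Rightarrow> triple_char n e1 e2 e3) =
        (case x of (e1, e2, e3) \<Rightarrow> three_edges_char n {e1, e2, e3})"
      by (simp add: x_eq)
  qed
  finally show ?thesis
    unfolding sum_distinct_triples[OF fin] sum_constant card_rest by (simp only: mult.commute)
qed

text \<open>Applied twice in the end: to the character, and to the constant 1, where it counts all
  three-edge subsets.\<close>

lemma sum_by_vertex_count:
  assumes E: "E \<subseteq> [{1..n}]\<^bsup>2\<^esup>" and f: "\<And>F. F \<in> [E]\<^bsup>3\<^esup> \<Longrightarrow> f F = g (card (\<Union>F))"
  shows "(\<Sum>F\<in>[E]\<^bsup>3\<^esup>. f F :: complex) = of_nat (triangles E) * g 3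
    + (of_nat (stars n E) + of_nat (paths E)) * g 4
    + of_nat (path_plus_edges E) * g 5 + of_nat (three_matchings E) * g 6"
proof -
  have fin: "finite ([E]\<^bsup>3\<^esup>)"
    by (intro finite_imp_finite_nsets finite_subset[OF E]) simp
  have img: "(\<lambda>F. card (\<Union>F)) ` [E]\<^bsup>3\<^esup> \<subseteq> {3, 4, 5, 6}"
    using card_Union_three_pairs[OF E] by blast
  have "(\<Sum>F\<in>[E]\<^bsup>3\<^esup>. f F) = (\<Sum>k\<in>{3, 4, 5, 6}. \<Sum>F\<in>{F \<in> [E]\<^bsup>3\<^esup>. card (\<Union>F) = k}. f F)"
    by (rule sum.group[OF fin _ img, symmetric]) simp
  also have "\<dots> = (\<Sum>k\<in>{3, 4, 5, 6}. of_nat (card {F \<in> [E]\<^bsup>3\<^esup>. card (\<Union>F) = k}) * g k)"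
    by (intro sum.cong refl) (simp add: f)
  also have "\<dots> = of_nat (triangles E) * g 3
    + (of_nat (stars n E) + of_nat (paths E)) * g 4
    + of_nat (path_plus_edges E) * g 5 + of_nat (three_matchings E) * g 6"
    by (simp add: card_triangles[OF E] card_stars_paths[OF E] card_path_plus_edges[OF E]
        card_matchings[OF E])
  finally show ?thesis .
qed

theorem mainTheorem10:
  fixes n :: nat and E :: "nat set set"
    and m t s r q d3 :: nat and c2 c4 c32 c222 :: complex
  assumes "n \<ge> 4"
    and "E \<subseteq> [{1..n}]\<^bsup>2\<^esup>"
  defines "m \<equiv> card E"
    and "t \<equiv> triangles E"
    and "s \<equiv> stars n E"
    and "r \<equiv> paths E"
    and "q \<equiv> path_plus_edges E"
    and "d3 \<equiv> three_matchings E"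
    and "c2 \<equiv> (of_nat n - 3) * (of_nat n - 4) / 2"
    and "c4 \<equiv> (of_nat n ^ 2 - 11 * of_nat n + 28) / 2"
    and "c32 \<equiv> (of_nat n ^ 2 - 13 * of_nat n + 42) / 2"
    and "c222 \<equiv> (of_nat n ^ 2 - 15 * of_nat n + 60) / 2"
  shows
    "M32 n E =
        c2 * (of_nat m + 3 * of_nat m * (of_nat m - 1) + 6 * of_nat t)
        + 6 * c4 * (of_nat s + of_nat r) + 6 * c32 * of_nat q + 6 * c222 * of_nat d3
     \<and>
     M32 n E =
        c2 * (of_nat m + 3 * of_nat m * (of_nat m - 1) + 6 * of_nat t)
        + 6 * c222 * of_nat (m choose 3)
        + 6 * (c4 - c222) * (of_nat s + of_nat r)
        + 6 * (c32 - c222) * of_nat q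
        - 6 * c222 * of_nat t"
proof -
  have M: "M32 n E = c2 * (of_nat m + 3 * of_nat m * (of_nat m - 1)) + 6 * (\<Sum>F\<in>[E]\<^bsup>3\<^esup>. three_edges_char n F)"
    unfolding c2_def m_def by (rule M32_eq_three_edges_sum[OF assms(1,2)])
  have char_sum: "(\<Sum>F\<in>[E]\<^bsup>3\<^esup>. three_edges_char n F) =
      of_nat t * c2 + (of_nat s + of_nat r) * c4 + of_nat q * c32 + of_nat d3 * c222"
    unfolding t_def s_def r_def q_def d3_def
    by (subst sum_by_vertex_count[OF assms(2), where
          g = "\<lambda>k. if k = 3 then c2 else if k = 4 then c4 else if k = 5 then c32 else c222"])
      (simp_all add: three_edges_char_def c2_def c4_def c32_def c222_def)
  \<comment> \<open>Every three-edge subset has exactly one of the shapes; substituting this for the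
    binomial coefficient reduces the second formula to the first.\<close>
  have count: "of_nat (m choose 3) =
      (of_nat t + (of_nat s + of_nat r) + of_nat q + of_nat d3 :: complex)"
    unfolding t_def s_def r_def q_def d3_def m_def
    using sum_by_vertex_count[OF assms(2), where f = "\<lambda>_. 1" and g = "\<lambda>_. 1"]
    by (simp add: card_nsets)
  show ?thesis
    unfolding M char_sum count by (simp add: algebra_simps)
qed

end
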